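(* Assume that the CFL condition $$1-\tfrac12\,\beta\, C_{\mathrm{inv}}^2C_{I_H}^2H^{-2}\Delta t^2\ge\delta$$ holds for some $\delta>0$. Then the idealized method is stable, i.e., its solution $(\tilde u_n)_{n=0,\dots,N}$ satisfies $$\|\dot{\tilde u}_{n+1/2}\|+\|\nabla\tilde u_{n+1}\|\le C_s\Big(\Delta t\sum_{k=1}^n\|f(k\Delta t)\|+\|\dot{\tilde u}_{1/2}\|+\|\nabla\tilde u_0\|+\|\nabla\tilde u_1\|\Big)$$ with a generic constant $C_s$, where $\dot{\tilde u}_{n+1/2}:=(\tilde u_{n+1}-\tilde u_n)/\Delta t$.
   Context: $\Omega\subseteq\mathbb{R}^d$, $d\in\{2,3\}$, is a polygonal, convex, bounded Lipschitz domain and $\Gamma\subseteq\partial\Omega$ has non-zero measure. $V:=H^1_\Gamma(\Omega)$ is the space of $H^1(\Omega)$ functions with zero trace on $\Gamma$. $\|\cdot\|$ and $(\cdot,\cdot)$ denote the $L^2(\Omega)$ norm and scalar product. $A\in L^\infty(\Omega;\mathbb{R}^{d\times d}_{\mathrm{sym}})$ (thought of as varying on a small scale $0<\varepsilon\ll1$) satisfies $\alpha|\xi|^2\le A(x)\xi\cdot\xi$ and $|A(x)\xi|\le\beta|\xi|$ for all $\xi\in\mathbb{R}^d$ and almost all $x\in\Omega$, with $0<\alpha\le\beta<\infty$, and $a(u,v):=\int_\Omega A\nabla u\cdot\nabla v\,dx$. $\mathcal{T}_H$ is a quasi-uniform shape regular mesh on $\Omega$ with mesh size $H>\varepsilon$,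 and $V_H\subset V$ is the corresponding standard $P_1$/$Q_1$ finite element space. $C_{\mathrm{inv}}$ is the constant of the standard inverse inequality $\|\nabla v_H\|\le C_{\mathrm{inv}}H^{-1}\|v_H\|$ for all $v_H\in V_H$. $I_H:V\to V_H$ is a projective quasi-interpolation operator satisfying, for all $v\in V$, $\|H^{-1}(v-I_Hv)\|+\|\nabla I_Hv\|\le C_{I_H}\|\nabla v\|$ and $\|I_Hv\|\le C_{I_H}\|v\|$, where $C_{I_H}$ depends only on the shape regularity of the mesh and not on $H$. $W:=\operatorname{Ker} I_H\subset V$. For $v\in V$ the corrector $\mathcal{C}v\in W$ is defined by $a(\mathcal{C}v,w)=a(v,w)$ for all $w\in W$. $\tilde V_H:=(1-\mathcal{C})V_H$. Idealized method (for the wave equation $\ddot u-\operatorname{div}A\nabla u=f$ on $(0,T)\times\Omega$ with initial value $u(0)=u_0\in V$ and right-hand side $f$): with time step $\Delta t$ and $N=\lceil T/\Delta t\rceil$ time steps, given $\tilde u_0=(1-\mathcal{C})I_Hu_0$ and suitable $\tilde u_1\in\tilde V_H$, find $(\tilde u_n)_{n=0,\dots,N}$ with $\tilde u_n\in\tilde V_H$ such that, for $n\ge1$ and all $\tilde v_H\in\tilde V_H$, $$\Delta t^{-2}(\tilde u_{n+1}-2\tilde u_n+\tilde u_{n-1},\tilde v_H)+a(\tilde u_n,\tilde v_H)=(f(n\Delta t),\tilde v_H).$$ *)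

theory Defs
  imports "HOL-Analysis.Analysis"
begin

text \<open>
  Elements of Lebesgue and Sobolev spaces are represented by functions on the whole space; only
  their values almost everywhere in \<open>\<Omega>\<close> matter.  Consequently all spaces of such functions
  below are closed under a.e. equality, and equations between their elements are a.e. equations.
\<close>

definition eq_ae :: "(real^'n) set \<Rightarrow> (real^'n \<Rightarrow> 'b) \<Rightarrow> (real^'n \<Rightarrow> 'b) \<Rightarrow> bool" where
  "eq_ae \<Omega> u v \<longleftrightarrow> (AE x in lebesgue_on \<Omega>. u x = v x)"

definition L2 :: "(real^'n) set \<Rightarrow> (real^'n \<Rightarrow> 'b::euclidean_space) set" where
  "L2 \<Omega> = {u. u \<in> borel_measurable (lebesgue_on \<Omega>) \<and> integrable (lebesgue_on \<Omega>) (\<lambda>x. (norm (u x))\<^sup>2)}"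

definition L2_norm :: "(real^'n) set \<Rightarrow> (real^'n \<Rightarrow> 'b::euclidean_space) \<Rightarrow> real" where
  "L2_norm \<Omega> u = sqrt (LINT x|lebesgue_on \<Omega>. (norm (u x))\<^sup>2)"

definition L2_inner :: "(real^'n) set \<Rightarrow> (real^'n \<Rightarrow> real) \<Rightarrow> (real^'n \<Rightarrow> real) \<Rightarrow> real" where
  "L2_inner \<Omega> u v = (LINT x|lebesgue_on \<Omega>. u x * v x)"

primrec Ck :: "nat \<Rightarrow> (real^'n \<Rightarrow> real) \<Rightarrow> bool" where
  "Ck 0 f \<longleftrightarrow> continuous_on UNIV f"
| "Ck (Suc k) f \<longleftrightarrow> (\<exists>D :: 'n \<Rightarrow> real^'n \<Rightarrow> real. (\<forall>i. Ck k (D i)) \<and>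
     (\<forall>x. (f has_derivative (\<lambda>h. \<Sum>i\<in>UNIV. h $ i * D i x)) (at x)))"

definition smooth :: "(real^'n \<Rightarrow> real) \<Rightarrow> bool" where
  "smooth f \<longleftrightarrow> (\<forall>k. Ck k f)"

definition test_functions :: "(real^'n) set \<Rightarrow> (real^'n \<Rightarrow> real) set" where
  "test_functions \<Omega> = {\<phi>. smooth \<phi> \<and> compact (closure {x. \<phi> x \<noteq> 0}) \<and> closure {x. \<phi> x \<noteq> 0} \<subseteq> \<Omega>}"

definition weak_gradient :: "(real^'n) set \<Rightarrow> (real^'n \<Rightarrow> real) \<Rightarrow> (real^'n \<Rightarrow> real^'n) \<Rightarrow> bool" where
  "weak_gradient \<Omega> u g \<longleftrightarrow> (\<forall>\<phi>\<in>test_functions \<Omega>. \<forall>i.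
     (LINT x|lebesgue_on \<Omega>. u x * frechet_derivative \<phi> (at x) (axis i 1)) =
     - (LINT x|lebesgue_on \<Omega>. g x $ i * \<phi> x))"

definition H1 :: "(real^'n) set \<Rightarrow> (real^'n \<Rightarrow> real) set" where
  "H1 \<Omega> = {u \<in> L2 \<Omega>. \<exists>g\<in>L2 \<Omega>. weak_gradient \<Omega> u g}"

text \<open>The weak gradient is unique up to a.e. equality, so the choice is immaterial.\<close>

definition grad :: "(real^'n) set \<Rightarrow> (real^'n \<Rightarrow> real) \<Rightarrow> real^'n \<Rightarrow> real^'n" where
  "grad \<Omega> u = (SOME g. g \<in> L2 \<Omega> \<and> weak_gradient \<Omega> u g)"

definition H1_norm :: "(real^'n) set \<Rightarrow> (real^'n \<Rightarrow> real) \<Rightarrow> real" where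
  "H1_norm \<Omega> u = sqrt ((L2_norm \<Omega> u)\<^sup>2 + (L2_norm \<Omega> (grad \<Omega> u))\<^sup>2)"

text \<open>
  Hausdorff outer measure, without the normalising factor, which is irrelevant for null sets and
  for \<open>L\<^sup>2\<close> convergence.
\<close>

definition hausdorff_outer :: "nat \<Rightarrow> (real^'n) set \<Rightarrow> ennreal" where
  "hausdorff_outer s S = (SUP r\<in>{0<..}. INF U\<in>{U :: nat \<Rightarrow> (real^'n) set. S \<subseteq> (\<Union>i. U i) \<and>
      (\<forall>i. bounded (U i) \<and> diameter (U i) \<le> r)}. \<Sum>i. ennreal (diameter (U i) ^ s))"

definition surface_measure :: "(real^'n) measure" where
  "surface_measure = measure_of UNIV (sets borel) (hausdorff_outer (CARD('n) - 1))"

text \<open>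
  The trace operator is the continuous extension to \<open>H1 \<Omega>\<close> of the restriction of smooth
  functions to the boundary.
\<close>

definition has_trace :: "(real^'n) set \<Rightarrow> (real^'n \<Rightarrow> real) \<Rightarrow> (real^'n \<Rightarrow> real) \<Rightarrow> bool" where
  "has_trace \<Omega> u g \<longleftrightarrow> g \<in> borel_measurable (restrict_space surface_measure (frontier \<Omega>)) \<and>
     (\<exists>\<phi> :: nat \<Rightarrow> real^'n \<Rightarrow> real. (\<forall>k. smooth (\<phi> k) \<and> \<phi> k \<in> H1 \<Omega>) \<and>
        (\<lambda>k. H1_norm \<Omega> (\<lambda>x. \<phi> k x - u x)) \<longlonglongrightarrow> 0 \<and>
        (\<lambda>k. \<integral>\<^sup>+ x. ennreal ((\<phi> k x - g x)\<^sup>2) \<partial>restrict_space surface_measure (frontier \<Omega>))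
          \<longlonglongrightarrow> 0)"

definition H1_zero_on :: "(real^'n) set \<Rightarrow> (real^'n) set \<Rightarrow> (real^'n \<Rightarrow> real) set" where
  "H1_zero_on \<Omega> \<Gamma> = {u \<in> H1 \<Omega>. \<exists>g. has_trace \<Omega> u g \<and> (AE x in surface_measure. x \<in> \<Gamma> \<longrightarrow> g x = 0)}"

text \<open>Every bounded convex domain is a Lipschitz domain.\<close>

definition polygonal_convex_domain :: "(real^'n) set \<Rightarrow> bool" where
  "polygonal_convex_domain \<Omega> \<longleftrightarrow> open \<Omega> \<and> \<Omega> \<noteq> {} \<and> bounded \<Omega> \<and> convex \<Omega> \<and> polytope (closure \<Omega>)"

definition coefficient :: "(real^'n) set \<Rightarrow> real \<Rightarrow> real \<Rightarrow> (real^'n \<Rightarrow> real^'n^'n) \<Rightarrow> bool" where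
  "coefficient \<Omega> \<alpha> \<beta> A \<longleftrightarrow>
     A \<in> borel_measurable (lebesgue_on \<Omega>) \<and> (\<exists>K. AE x in lebesgue_on \<Omega>. norm (A x) \<le> K) \<and>
     (AE x in lebesgue_on \<Omega>. transpose (A x) = A x) \<and>
     (AE x in lebesgue_on \<Omega>. \<forall>\<xi>. \<alpha> * (norm \<xi>)\<^sup>2 \<le> (A x *v \<xi>) \<bullet> \<xi> \<and> norm (A x *v \<xi>) \<le> \<beta> * norm \<xi>)"

definition energy_form ::
  "(real^'n) set \<Rightarrow> (real^'n \<Rightarrow> real^'n^'n) \<Rightarrow> (real^'n \<Rightarrow> real) \<Rightarrow> (real^'n \<Rightarrow> real) \<Rightarrow> real" where
  "energy_form \<Omega> A u v = (LINT x|lebesgue_on \<Omega>. (A x *v grad \<Omega> u x) \<bullet> grad \<Omega> v x)"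

text \<open>
  An element is the image of the reference simplex (\<open>P1\<close>) or reference cube (\<open>Q1\<close>) under an
  injective map whose components are shape functions; a mesh is the set of these maps.
\<close>

datatype fe_kind = P1 | Q1

primrec ref_element :: "fe_kind \<Rightarrow> (real^'n) set" where
  "ref_element P1 = convex hull (insert 0 Basis)"
| "ref_element Q1 = cbox 0 1"

primrec shape_functions :: "fe_kind \<Rightarrow> (real^'n \<Rightarrow> real) set" where
  "shape_functions P1 = {p. \<exists>a b. p = (\<lambda>x. a + b \<bullet> x)}"
| "shape_functions Q1 = {p. \<exists>c. p = (\<lambda>x. \<Sum>S\<in>UNIV. c S * (\<Prod>i\<in>S. x $ i))}"

abbreviation element :: "fe_kind \<Rightarrow> (real^'n \<Rightarrow> real^'n) \<Rightarrow> (real^'n) set" where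
  "element k F \<equiv> F ` ref_element k"

text \<open>
  Matching the faces as sets is not enough, the vertices have to match as well, because a set can
  be the image of faces of the reference cube with different vertices (e.g. a quadrilateral with a straight angle).
\<close>

definition conforming :: "fe_kind \<Rightarrow> (real^'n \<Rightarrow> real^'n) \<Rightarrow> (real^'n \<Rightarrow> real^'n) \<Rightarrow> bool" where
  "conforming k F G \<longleftrightarrow> (\<exists>K L. K face_of ref_element k \<and> L face_of ref_element k \<and>
     element k F \<inter> element k G = F ` K \<and> element k F \<inter> element k G = G ` L \<and>
     F ` {v. v extreme_point_of K} = G ` {v. v extreme_point_of L})"

definition is_mesh :: "(real^'n) set \<Rightarrow> fe_kind \<Rightarrow> (real^'n \<Rightarrow> real^'n) set \<Rightarrow> bool" where
  "is_mesh \<Omega> k \<T> \<longleftrightarrow> finite \<T> \<and>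
     (\<forall>F\<in>\<T>. (\<forall>i. (\<lambda>x. F x $ i) \<in> shape_functions k) \<and> inj_on F (ref_element k)) \<and>
     (\<Union>F\<in>\<T>. element k F) = closure \<Omega> \<and>
     (\<forall>F\<in>\<T>. \<forall>G\<in>\<T>. F \<noteq> G \<longrightarrow>
        interior (element k F) \<inter> interior (element k G) = {} \<and> conforming k F G)"

definition mesh_size :: "fe_kind \<Rightarrow> (real^'n \<Rightarrow> real^'n) set \<Rightarrow> real" where
  "mesh_size k \<T> = Max ((\<lambda>F. diameter (element k F)) ` \<T>)"

text \<open>
  Shape regularity: for simplices, diameter over radius of an inscribed ball is bounded; for
  images of the cube, the bound is on the Jacobian of the (in general non-affine) element map.
\<close>

primrec shape_regular_element :: "fe_kind \<Rightarrow> real \<Rightarrow> (real^'n \<Rightarrow> real^'n) \<Rightarrow> bool" where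
  "shape_regular_element P1 \<gamma> F \<longleftrightarrow>
     (\<exists>x r. 0 < r \<and> ball x r \<subseteq> element P1 F \<and> diameter (element P1 F) \<le> \<gamma> * r)"
| "shape_regular_element Q1 \<gamma> F \<longleftrightarrow>
     (\<forall>x\<in>ref_element Q1. \<forall>\<xi>.
        diameter (element Q1 F) * norm \<xi> \<le> \<gamma> * norm (frechet_derivative F (at x) \<xi>) \<and>
        norm (frechet_derivative F (at x) \<xi>) \<le> \<gamma> * diameter (element Q1 F) * norm \<xi>)"

definition shape_regular :: "fe_kind \<Rightarrow> real \<Rightarrow> (real^'n \<Rightarrow> real^'n) set \<Rightarrow> bool" where
  "shape_regular k \<gamma> \<T> \<longleftrightarrow> (\<forall>F\<in>\<T>. shape_regular_element k \<gamma> F)"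

definition quasi_uniform :: "fe_kind \<Rightarrow> real \<Rightarrow> (real^'n \<Rightarrow> real^'n) set \<Rightarrow> bool" where
  "quasi_uniform k \<kappa> \<T> \<longleftrightarrow> (\<forall>F\<in>\<T>. mesh_size k \<T> \<le> \<kappa> * diameter (element k F))"

definition fe_space ::
  "(real^'n) set \<Rightarrow> (real^'n) set \<Rightarrow> fe_kind \<Rightarrow> (real^'n \<Rightarrow> real^'n) set \<Rightarrow> (real^'n \<Rightarrow> real) set" where
  "fe_space \<Omega> \<Gamma> k \<T> = {v \<in> H1_zero_on \<Omega> \<Gamma>. \<exists>g. eq_ae \<Omega> v g \<and> continuous_on (closure \<Omega>) g \<and>
     (\<forall>F\<in>\<T>. \<exists>p\<in>shape_functions k. \<forall>x\<in>ref_element k. g (F x) = p x)}"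

definition inverse_inequality ::
  "(real^'n) set \<Rightarrow> (real^'n \<Rightarrow> real) set \<Rightarrow> real \<Rightarrow> real \<Rightarrow> bool" where
  "inverse_inequality \<Omega> V\<^sub>H H C\<^sub>i\<^sub>n\<^sub>v \<longleftrightarrow>
     (\<forall>v\<in>V\<^sub>H. L2_norm \<Omega> (grad \<Omega> v) \<le> C\<^sub>i\<^sub>n\<^sub>v * inverse H * L2_norm \<Omega> v)"

definition quasi_interpolation ::
  "(real^'n) set \<Rightarrow> (real^'n \<Rightarrow> real) set \<Rightarrow> (real^'n \<Rightarrow> real) set \<Rightarrow> real \<Rightarrow> real \<Rightarrow>
   ((real^'n \<Rightarrow> real) \<Rightarrow> real^'n \<Rightarrow> real) \<Rightarrow> bool" where
  "quasi_interpolation \<Omega> V V\<^sub>H H C I \<longleftrightarrow>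
     (\<forall>v\<in>V. I v \<in> V\<^sub>H) \<and>
     (\<forall>v\<in>V. \<forall>w\<in>V. eq_ae \<Omega> v w \<longrightarrow> eq_ae \<Omega> (I v) (I w)) \<and>
     (\<forall>v\<in>V. \<forall>w\<in>V. \<forall>a b. eq_ae \<Omega> (I (\<lambda>x. a * v x + b * w x)) (\<lambda>x. a * I v x + b * I w x)) \<and>
     (\<forall>v\<in>V\<^sub>H. eq_ae \<Omega> (I v) v) \<and>
     (\<forall>v\<in>V. L2_norm \<Omega> (\<lambda>x. inverse H * (v x - I v x)) + L2_norm \<Omega> (grad \<Omega> (I v))
              \<le> C * L2_norm \<Omega> (grad \<Omega> v)) \<and>
     (\<forall>v\<in>V. L2_norm \<Omega> (I v) \<le> C * L2_norm \<Omega> v)"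

definition interp_kernel ::
  "(real^'n) set \<Rightarrow> (real^'n \<Rightarrow> real) set \<Rightarrow> ((real^'n \<Rightarrow> real) \<Rightarrow> real^'n \<Rightarrow> real) \<Rightarrow>
   (real^'n \<Rightarrow> real) set" where
  "interp_kernel \<Omega> V I = {w \<in> V. eq_ae \<Omega> (I w) (\<lambda>x. 0)}"

text \<open>
  \<open>c\<close> is the corrector of \<open>v\<close>; it exists and is a.e. unique by the Lax--Milgram theorem.
\<close>

definition is_corrector ::
  "(real^'n) set \<Rightarrow> (real^'n \<Rightarrow> real^'n^'n) \<Rightarrow> (real^'n \<Rightarrow> real) set \<Rightarrow>
   (real^'n \<Rightarrow> real) \<Rightarrow> (real^'n \<Rightarrow> real) \<Rightarrow> bool" where
  "is_corrector \<Omega> A W v c \<longleftrightarrow> c \<in> W \<and> (\<forall>w\<in>W. energy_form \<Omega> A c w = energy_form \<Omega> A v w)"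

definition is_corrected ::
  "(real^'n) set \<Rightarrow> (real^'n \<Rightarrow> real^'n^'n) \<Rightarrow> (real^'n \<Rightarrow> real) set \<Rightarrow>
   (real^'n \<Rightarrow> real) \<Rightarrow> (real^'n \<Rightarrow> real) \<Rightarrow> bool" where
  "is_corrected \<Omega> A W v u \<longleftrightarrow> (\<exists>c. is_corrector \<Omega> A W v c \<and> eq_ae \<Omega> u (\<lambda>x. v x - c x))"

definition multiscale_space ::
  "(real^'n) set \<Rightarrow> (real^'n \<Rightarrow> real^'n^'n) \<Rightarrow> (real^'n \<Rightarrow> real) set \<Rightarrow> (real^'n \<Rightarrow> real) set \<Rightarrow>
   (real^'n \<Rightarrow> real) set" where
  "multiscale_space \<Omega> A W V\<^sub>H = {u. \<exists>v\<in>V\<^sub>H. is_corrected \<Omega> A W v u}"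

definition num_steps :: "real \<Rightarrow> real \<Rightarrow> nat" where
  "num_steps T \<Delta>t = nat \<lceil>T / \<Delta>t\<rceil>"

definition diff_quot :: "real \<Rightarrow> (nat \<Rightarrow> real^'n \<Rightarrow> real) \<Rightarrow> nat \<Rightarrow> real^'n \<Rightarrow> real" where
  "diff_quot \<Delta>t u n = (\<lambda>x. (u (Suc n) x - u n x) / \<Delta>t)"

definition idealized_solution ::
  "(real^'n) set \<Rightarrow> (real^'n \<Rightarrow> real^'n^'n) \<Rightarrow> (real^'n \<Rightarrow> real) set \<Rightarrow> (real^'n \<Rightarrow> real) set \<Rightarrow>
   ((real^'n \<Rightarrow> real) \<Rightarrow> real^'n \<Rightarrow> real) \<Rightarrow> real \<Rightarrow> real \<Rightarrow> (real \<Rightarrow> real^'n \<Rightarrow> real) \<Rightarrow>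
   (real^'n \<Rightarrow> real) \<Rightarrow> (nat \<Rightarrow> real^'n \<Rightarrow> real) \<Rightarrow> bool" where
  "idealized_solution \<Omega> A V V\<^sub>H I T \<Delta>t f u\<^sub>0 u \<longleftrightarrow>
     (let W = interp_kernel \<Omega> V I; VT = multiscale_space \<Omega> A W V\<^sub>H; N = num_steps T \<Delta>t in
       is_corrected \<Omega> A W (I u\<^sub>0) (u 0) \<and>
       (\<forall>n\<le>N. u n \<in> VT) \<and>
       (\<forall>n. 1 \<le> n \<and> n < N \<longrightarrow> (\<forall>v\<in>VT.
          inverse (\<Delta>t\<^sup>2) * L2_inner \<Omega> (\<lambda>x. u (n + 1) x - 2 * u n x + u (n - 1) x) v
            + energy_form \<Omega> A (u n) v = L2_inner \<Omega> (f (real n * \<Delta>t)) v)))"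

end

theory Submission
  imports Defs
begin

text \<open>
  The proof is the energy argument for the leapfrog scheme.  Write \<open>d n\<close> for the difference quotient
  \<open>(u (n + 1) - u n) / \<Delta>t\<close> and let the discrete energy be \<open>E n = \<parallel>d n\<parallel>\<^sup>2 + a (u n, u (n + 1))\<close>.
  Testing the scheme with \<open>u (n + 1) - u (n - 1)\<close> gives
  \<open>E n - E (n - 1) = \<Delta>t * (f n, d n + d (n - 1))\<close>, so the energy changes only through the source
  (\<open>discrete_energy_step\<close>).

  Stability needs the energy to be positive, although its second term has no sign.  By
  polarisation, \<open>a (u n, u (n + 1))\<close> is the mean of the energies of \<open>u n\<close> and \<open>u (n + 1)\<close> minus
  \<open>\<Delta>t\<^sup>2 / 2 * a (d n, d n)\<close>, and the multiscale functions, although they oscillate on the fine scale,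
  satisfy an inverse inequality with the coarse mesh size: \<open>VT_inverse_inequality\<close> bounds
  \<open>a (d n, d n)\<close> by \<open>\<beta> * C\<^sub>i\<^sub>n\<^sub>v\<^sup>2 * C\<^sub>I\<^sup>2 / H\<^sup>2 * \<parallel>d n\<parallel>\<^sup>2\<close>.  With the CFL condition this yields
  \<open>E n \<ge> \<delta> * \<parallel>d n\<parallel>\<^sup>2 + \<alpha> / 2 * \<parallel>\<nabla>u (n + 1)\<parallel>\<^sup>2\<close> (\<open>discrete_energy_ge\<close>).  Now
  \<open>\<parallel>d n\<parallel> \<le> sqrt (E n / \<delta>)\<close> can be inserted into the energy increment, and dividing by
  \<open>sqrt (E n) + sqrt (E (n - 1))\<close> shows that \<open>sqrt (E n)\<close> grows by at most
  \<open>\<Delta>t * \<parallel>f n\<parallel> / sqrt \<delta>\<close> per step (\<open>sqrt_energy_growth\<close>).  The resulting constant depends on \<open>\<alpha>\<close>,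
  \<open>\<beta>\<close> and \<open>\<delta>\<close> only.

  The argument uses freely that gradients, traces and finite element functions form linear spaces
  and that the energy form is bilinear.  As gradients are chosen representatives of weak gradients,
  this rests on the uniqueness of weak gradients up to null sets (\<open>weak_gradient_unique\<close>), which is
  derived from the fundamental lemma of the calculus of variations with explicit smooth bump
  functions on boxes.
\<close>

section \<open>Smooth bump functions\<close>

lemma Ck_Suc_imp_Ck: "Ck (Suc k) f \<Longrightarrow> Ck k f"
proof (induction k arbitrary: f)
  case 0
  then show ?case
    by (auto simp: continuous_on_eq_continuous_at intro: has_derivative_continuous)
next
  case (Suc k)
  then obtain D where "\<forall>i. Ck (Suc k) (D i)"
    "\<forall>x. (f has_derivative (\<lambda>h. \<Sum>i\<in>UNIV. h $ i * D i x)) (at x)"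
    by (subst (asm) Ck.simps(2)) blast
  then show ?case
    using Suc.IH by (auto intro!: exI[of _ D])
qed

lemma Ck_const: "Ck k (\<lambda>x. c)"
  by (induction k arbitrary: c) (auto intro!: exI[of _ "\<lambda>_ _. 0"])

lemma Ck_add: "Ck k f \<Longrightarrow> Ck k g \<Longrightarrow> Ck k (\<lambda>x. f x + g x)"
proof (induction k arbitrary: f g)
  case 0
  then show ?case by (auto intro: continuous_intros)
next
  case (Suc k)
  obtain D where D: "\<forall>i. Ck k (D i)"
    "\<forall>x. (f has_derivative (\<lambda>h. \<Sum>i\<in>UNIV. h $ i * D i x)) (at x)"
    using Suc.prems(1) by auto
  obtain E where E: "\<forall>i. Ck k (E i)"
    "\<forall>x. (g has_derivative (\<lambda>h. \<Sum>i\<in>UNIV. h $ i * E i x)) (at x)"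
    using Suc.prems(2) by auto
  have "((\<lambda>x. f x + g x) has_derivative (\<lambda>h. \<Sum>i\<in>UNIV. h $ i * (D i x + E i x))) (at x)" for x
    using has_derivative_add[OF D(2)[rule_format, of x] E(2)[rule_format, of x]]
    by (simp add: sum.distrib distrib_left)
  then show ?case
    using Suc.IH D(1) E(1) by (auto intro!: exI[of _ "\<lambda>i x. D i x + E i x"])
qed

lemma Ck_mult: "Ck k f \<Longrightarrow> Ck k g \<Longrightarrow> Ck k (\<lambda>x. f x * g x)"
proof (induction k arbitrary: f g)
  case 0
  then show ?case by (auto intro: continuous_intros)
next
  case (Suc k)
  obtain D where D: "\<forall>i. Ck k (D i)"
    "\<forall>x. (f has_derivative (\<lambda>h. \<Sum>i\<in>UNIV. h $ i * D i x)) (at x)"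
    using Suc.prems(1) by auto
  obtain E where E: "\<forall>i. Ck k (E i)"
    "\<forall>x. (g has_derivative (\<lambda>h. \<Sum>i\<in>UNIV. h $ i * E i x)) (at x)"
    using Suc.prems(2) by auto
  have "((\<lambda>x. f x * g x) has_derivative (\<lambda>h. \<Sum>i\<in>UNIV. h $ i * (f x * E i x + D i x * g x))) (at x)" for x
    using has_derivative_mult[OF D(2)[rule_format, of x] E(2)[rule_format, of x]]
    by (rule has_derivative_eq_rhs)
      (simp add: sum.distrib distrib_left sum_distrib_left sum_distrib_right mult_ac)
  moreover have "Ck k (\<lambda>x. f x * E i x + D i x * g x)" for i
    using Suc.prems[THEN Ck_Suc_imp_Ck] D(1) E(1) by (intro Ck_add Suc.IH) auto
  ultimately show ?case
    by (auto intro!: exI[of _ "\<lambda>i x. f x * E i x + D i x * g x"])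
qed

lemma Ck_prod: "finite S \<Longrightarrow> (\<And>i. i \<in> S \<Longrightarrow> Ck k (f i)) \<Longrightarrow> Ck k (\<lambda>x. \<Prod>i\<in>S. f i x)"
  by (induction S rule: finite_induct) (auto intro: Ck_const Ck_mult)

lemma smooth_linear: "smooth f \<Longrightarrow> smooth g \<Longrightarrow> smooth (\<lambda>x. a * f x + b * g x)"
  unfolding smooth_def by (intro allI Ck_add Ck_mult Ck_const) simp_all

text \<open>
  The classical function \<open>exp (- 1 / t)\<close>, extended by zero to \<open>t \<le> 0\<close>, is the case \<open>j = 0\<close>.  The
  extra powers of \<open>1 / t\<close> make the family closed under differentiation up to linear combinations,
  so that smoothness is an induction on the number of derivatives.
\<close>

definition flat_exp :: "nat \<Rightarrow> real \<Rightarrow> real" where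
  "flat_exp j t = (if 0 < t then inverse t ^ j * exp (- inverse t) else 0)"

lemma flat_exp_tendsto_0: "(flat_exp j \<longlongrightarrow> 0) (at 0)"
proof (rule filterlim_split_at)
  have "eventually (\<lambda>t. 0 = flat_exp j t) (at_left (0::real))"
    by (simp add: flat_exp_def eventually_at_filter)
  then show "(flat_exp j \<longlongrightarrow> 0) (at_left 0)"
    by (rule Lim_transform_eventually[rotated]) simp
  have "((\<lambda>t. inverse t ^ j / exp (inverse t)) \<longlongrightarrow> 0) (at_right (0::real))"
    by (rule filterlim_compose[OF tendsto_power_div_exp_0 filterlim_inverse_at_top_right])
  moreover have "eventually (\<lambda>t. inverse t ^ j / exp (inverse t) = flat_exp j t) (at_right (0::real))"
    by (auto simp: flat_exp_def eventually_at_filter exp_minus divide_simps)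
  ultimately show "(flat_exp j \<longlongrightarrow> 0) (at_right 0)"
    by (rule Lim_transform_eventually)
qed

lemma DERIV_flat_exp:
  "(flat_exp j has_field_derivative flat_exp (j + 2) t - real j * flat_exp (j + 1) t) (at t)"
proof -
  consider "t < 0" | "t = 0" | "0 < t" by linarith
  then show ?thesis
  proof cases
    case 1
    have "((\<lambda>t. 0) has_field_derivative 0) (at t)" by simp
    then have "(flat_exp j has_field_derivative 0) (at t)"
      by (rule has_field_derivative_transform_within_open[of _ _ _ "{..<0}"])
        (use 1 in \<open>auto simp: flat_exp_def\<close>)
    with 1 show ?thesis by (simp add: flat_exp_def)
  next
    case 2
    have "((\<lambda>h. flat_exp j h / h) \<longlongrightarrow> 0) (at 0)"
      using flat_exp_tendsto_0[of "Suc j"]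
      by (rule Lim_transform_eventually) (auto simp: flat_exp_def eventually_at_filter divide_simps)
    with 2 show ?thesis by (simp add: DERIV_def flat_exp_def)
  next
    case 3
    have inv: "(inverse has_field_derivative - (inverse t)\<^sup>2) (at t)"
      using 3 DERIV_inverse[of t] by (simp add: power2_eq_square)
    have "((\<lambda>t. inverse t ^ j) has_field_derivative - real j * inverse t ^ (j + 1)) (at t)"
      using DERIV_power[OF inv, of j] by (cases j) (auto simp: power2_eq_square algebra_simps)
    moreover have "((\<lambda>t. exp (- inverse t)) has_field_derivative exp (- inverse t) * (inverse t)\<^sup>2) (at t)"
      using DERIV_chain2[OF DERIV_exp DERIV_minus[OF inv]] by simp
    ultimately have "((\<lambda>t. inverse t ^ j * exp (- inverse t)) has_field_derivative
        flat_exp (j + 2) t - real j * flat_exp (j + 1) t) (at t)"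
      by (rule DERIV_cong[OF DERIV_mult])
        (use 3 in \<open>simp add: flat_exp_def power2_eq_square algebra_simps\<close>)
    then show ?thesis
      by (rule has_field_derivative_transform_within_open[of _ _ _ "{0<..}"])
        (use 3 in \<open>auto simp: flat_exp_def\<close>)
  qed
qed

text \<open>
  Each derivative only raises the index \<open>j\<close>, so the induction hypothesis for all \<open>j\<close> covers it.
\<close>

lemma Ck_flat_exp: "Ck k (\<lambda>x. flat_exp j (c + d * x $ i))"
proof (induction k arbitrary: j)
  have D: "((\<lambda>x::real^'a. flat_exp j (c + d * x $ i)) has_derivative (\<lambda>h. \<Sum>i'\<in>UNIV. h $ i' *
     (if i' = i then d else 0) *
       (flat_exp (j + 2) (c + d * x $ i) + (- real j) * flat_exp (j + 1) (c + d * x $ i)))) (at x)" for j x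
  proof -
    have "((\<lambda>x::real^'a. c + d * x $ i) has_derivative (\<lambda>h. d * h $ i)) (at x)"
      by (auto intro!: derivative_eq_intros bounded_linear.has_derivative[OF bounded_linear_vec_nth])
    note has_derivative_compose[OF this DERIV_flat_exp[unfolded has_field_derivative_def]]
    then show ?thesis
      by (rule has_derivative_eq_rhs) (simp add: if_distrib if_distribR algebra_simps cong: if_cong)
  qed
  {
    case 0
    show ?case
      using D by (auto intro!: has_derivative_continuous[OF D] continuous_at_imp_continuous_on)
  next
    case (Suc k)
    have "Ck k (\<lambda>x. (if i' = i then d else 0) *
       (flat_exp (j + 2) (c + d * x $ i) + (- real j) * flat_exp (j + 1) (c + d * x $ i)))" for i'
      by (intro Ck_add Ck_mult Ck_const Suc.IH)
    then show ?case
      using D[of j] by (auto simp only: Ck.simps mult.assoc intro!: exI[of _ "\<lambda>i' x. (if i' = i then d else 0) *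
       (flat_exp (j + 2) (c + d * x $ i) + (- real j) * flat_exp (j + 1) (c + d * x $ i))"])
  }
qed

text \<open>
  Because \<open>flat_exp 0 (m * t)\<close> tends to \<open>1\<close> for \<open>t > 0\<close> and vanishes otherwise, these products are
  smooth approximations of the indicator function of an open box, bounded by \<open>1\<close> and supported in
  the closed box.
\<close>

definition box_bump :: "real^'n \<Rightarrow> real^'n \<Rightarrow> nat \<Rightarrow> real^'n \<Rightarrow> real" where
  "box_bump a b m x =
     (\<Prod>i\<in>UNIV. flat_exp 0 (real m * (x $ i - a $ i)) * flat_exp 0 (real m * (b $ i - x $ i)))"

lemma smooth_box_bump: "smooth (box_bump a b m)"
proof -
  have "Ck k (\<lambda>x. flat_exp 0 (- real m * a $ i + real m * x $ i) * flat_exp 0 (real m * b $ i + (- real m) * x $ i))" for k i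
    by (intro Ck_mult Ck_flat_exp)
  then have "Ck k (\<lambda>x. \<Prod>i\<in>UNIV. flat_exp 0 (- real m * a $ i + real m * x $ i) * flat_exp 0 (real m * b $ i + (- real m) * x $ i))" for k
    by (intro Ck_prod) auto
  then show ?thesis
    by (simp add: smooth_def box_bump_def[abs_def] algebra_simps)
qed

lemma box_bump_eq_0: "x \<notin> box a b \<Longrightarrow> box_bump a b m x = 0"
  by (simp add: box_bump_def flat_exp_def mem_box_cart zero_less_mult_iff) (metis less_asym)

lemma box_bump_bounds: "0 \<le> box_bump a b m x" "box_bump a b m x \<le> 1"
proof -
  have *: "0 \<le> flat_exp 0 t" "flat_exp 0 t \<le> 1" for t by (auto simp: flat_exp_def)
  show "0 \<le> box_bump a b m x" "box_bump a b m x \<le> 1"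
    unfolding box_bump_def by (intro prod_nonneg prod_le_1 ballI conjI mult_nonneg_nonneg mult_le_one *)+
qed

lemma box_bump_tendsto:
  fixes a b x :: "real^'n"
  shows "(\<lambda>m. box_bump a b m x) \<longlonglongrightarrow> indicator (box a b) x"
proof (cases "x \<in> box a b")
  case True
  have "(\<lambda>m. flat_exp 0 (real m * t)) \<longlonglongrightarrow> 1" if "0 < t" for t
  proof -
    have "(\<lambda>m. exp (- (inverse t * inverse (real m)))) \<longlonglongrightarrow> exp (- (inverse t * 0))"
      by (intro tendsto_intros lim_inverse_n)
    moreover have "eventually (\<lambda>m. exp (- (inverse t * inverse (real m))) = flat_exp 0 (real m * t)) sequentially"
      using eventually_gt_at_top[of 0] by eventually_elim (use that in \<open>simp add: flat_exp_def mult.commute\<close>)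
    ultimately show ?thesis by (simp add: Lim_transform_eventually)
  qed
  then have "(\<lambda>m. box_bump a b m x) \<longlonglongrightarrow> (\<Prod>i\<in>(UNIV::'n set). 1 * 1)"
    unfolding box_bump_def by (intro tendsto_prod tendsto_mult) (use True in \<open>auto simp: mem_box_cart\<close>)
  with True show ?thesis by simp
qed (simp add: box_bump_eq_0)

lemma box_bump_test_function:
  assumes "cbox a b \<subseteq> \<Omega>"
  shows "box_bump a b m \<in> test_functions \<Omega>"
proof -
  have "closure {x. box_bump a b m x \<noteq> 0} \<subseteq> cbox a b"
    using box_bump_eq_0[of _ a b m] box_subset_cbox[of a b] by (intro closure_minimal) auto
  with assms show ?thesis
    using smooth_box_bump compact_Int_closed[OF compact_cbox, of "closure {x. box_bump a b m x \<noteq> 0}" a b]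
    by (auto simp: test_functions_def Int_absorb1)
qed

section \<open>The fundamental lemma of the calculus of variations\<close>

text \<open>
  Testing with the bump functions of a box and passing to the limit by dominated convergence shows
  that \<open>f\<close> has integral zero over every box inside \<open>\<Omega>\<close>.  At almost every point \<open>f\<close> is the limit of
  its averages over small boxes at this point, and these are zero as \<open>\<Omega>\<close> is open.
\<close>

lemma fundamental_lemma_of_variations:
  fixes f :: "real^'n \<Rightarrow> real"
  assumes \<Omega>: "open \<Omega>" and f: "integrable (lebesgue_on \<Omega>) f"
    and 0: "\<And>\<phi>. \<phi> \<in> test_functions \<Omega> \<Longrightarrow> (LINT x|lebesgue_on \<Omega>. f x * \<phi> x) = 0"
  shows "AE x in lebesgue_on \<Omega>. f x = 0"
proof -
  define F where "F x = (if x \<in> \<Omega> then f x else 0)" for x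
  have [simp]: "\<Omega> \<in> sets lebesgue" using \<Omega> by auto
  have F: "integrable lebesgue F"
  proof -
    have "F = (\<lambda>x. indicator \<Omega> x *\<^sub>R f x)" by (auto simp: F_def)
    with f show ?thesis by (simp add: integrable_restrict_space)
  qed
  have F_cbox: "F integrable_on cbox a b" for a b
    using integrable_on_lebesgue[OF F] integrable_on_subcbox[of F UNIV a b] by simp
  have F_cbox0: "integral (cbox a b) F = 0" if "cbox a b \<subseteq> \<Omega>" for a b
  proof -
    have [measurable]: "box_bump a b m \<in> borel_measurable lebesgue" for m
    proof -
      have "continuous_on UNIV (box_bump a b m)"
        using smooth_box_bump[of a b m] by (auto simp: smooth_def dest: spec[of _ 0])
      then show ?thesis by (intro measurable_completion) (simp add: borel_measurable_continuous_onI)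
    qed
    have "(\<lambda>m. LINT x|lebesgue. F x * box_bump a b m x) \<longlonglongrightarrow> (LINT x|lebesgue. F x * indicator (box a b) x)"
    proof (rule integral_dominated_convergence)
      show "integrable lebesgue (\<lambda>x. norm (F x))" using F by simp
      show "AE x in lebesgue. (\<lambda>m. F x * box_bump a b m x) \<longlonglongrightarrow> F x * indicator (box a b) x"
        by (intro AE_I2 tendsto_mult tendsto_const box_bump_tendsto)
      show "AE x in lebesgue. norm (F x * box_bump a b m x) \<le> norm (F x)" for m
        using box_bump_bounds[of a b m] by (auto simp: abs_mult mult_left_le)
      show "(\<lambda>x. F x * box_bump a b m x) \<in> borel_measurable lebesgue" for m
        using F by measurable
      show "(\<lambda>x. F x * indicator (box a b) x) \<in> borel_measurable lebesgue"
        using F by (intro borel_measurable_times borel_measurable_indicator) auto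
    qed
    moreover have "(LINT x|lebesgue. F x * box_bump a b m x) = 0" for m
    proof -
      have "(LINT x|lebesgue. F x * box_bump a b m x) = (LINT x|lebesgue_on \<Omega>. f x * box_bump a b m x)"
        by (subst integral_restrict_space) (auto simp: F_def intro!: Bochner_Integration.integral_cong)
      then show ?thesis using 0[OF box_bump_test_function[OF that]] by simp
    qed
    ultimately have "(LINT x|lebesgue. F x * indicator (box a b) x) = 0"
      using LIMSEQ_unique[of "\<lambda>m. 0::real"] by fastforce
    then have "(LINT x|lebesgue_on (box a b). F x) = 0"
      by (simp add: integral_restrict_space mult.commute)
    moreover have "integrable (lebesgue_on (box a b)) F"
      using integrable_mult_indicator[OF _ F, of "box a b"] by (simp add: integrable_restrict_space)
    ultimately have "integral (box a b) F = 0"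
      using lebesgue_integral_eq_integral[of "box a b" F] by simp
    then show ?thesis
      by (simp add: integral_open_interval)
  qed
  obtain N where N: "negligible N" and lim: "\<And>x e. \<lbrakk>x \<notin> N; 0 < e\<rbrakk> \<Longrightarrow>
      \<exists>d>0. \<forall>h. 0 < h \<and> h < d \<longrightarrow>
        norm (integral (cbox x (x + h *\<^sub>R One)) F /\<^sub>R h ^ DIM(real^'n) - F x) < e"
    using integrable_ccontinuous_explicit[OF F_cbox] by blast
  have "f x = 0" if x\<Omega>: "x \<in> \<Omega>" and xN: "x \<notin> N" for x
  proof (rule ccontr)
    assume "f x \<noteq> 0"
    then obtain d where "0 < d" and d: "\<And>h. 0 < h \<Longrightarrow> h < d \<Longrightarrow>
        norm (integral (cbox x (x + h *\<^sub>R One)) F /\<^sub>R h ^ DIM(real^'n) - F x) < \<bar>f x\<bar>"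
      using lim[OF xN, of "\<bar>f x\<bar>"] by auto
    obtain r where "0 < r" and r: "cball x r \<subseteq> \<Omega>"
      using \<Omega> x\<Omega> open_contains_cball by blast
    \<comment> \<open>small enough both for the average to be close to its limit and for the box to stay inside the domain\<close>
    define h where "h = min (d / 2) (r / norm (One::real^'n))"
    have h: "0 < h" "h < d" "h * norm (One::real^'n) \<le> r"
      using \<open>0 < d\<close> \<open>0 < r\<close> by (auto simp: h_def min_def divide_simps not_le)
    have "cbox x (x + h *\<^sub>R One) \<subseteq> cball x r"
    proof
      fix y assume y: "y \<in> cbox x (x + h *\<^sub>R One)"
      have "norm (y - x) \<le> norm (h *\<^sub>R (One::real^'n))"
        using y h(1) by (intro norm_le_componentwise) (auto simp: mem_box inner_diff_left inner_add_left abs_le_iff algebra_simps)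
      with h show "y \<in> cball x r" by (simp add: dist_norm norm_minus_commute)
    qed
    with d[OF h(1,2)] F_cbox0 r x\<Omega> show False by (simp add: F_def)
  qed
  moreover have "N \<in> null_sets lebesgue" using N by (simp add: negligible_iff_null_sets)
  ultimately show ?thesis
    by (subst AE_restrict_space_iff) (auto intro!: AE_I'[of N])
qed

section \<open>Square integrable functions\<close>

lemma L2_measurable: "u \<in> L2 \<Omega> \<Longrightarrow> u \<in> borel_measurable (lebesgue_on \<Omega>)"
  by (simp add: L2_def)

lemma L2_integrable_inner:
  fixes u v :: "real^'n \<Rightarrow> 'b::euclidean_space"
  assumes "u \<in> L2 \<Omega>" "v \<in> L2 \<Omega>"
  shows "integrable (lebesgue_on \<Omega>) (\<lambda>x. norm (u x) * norm (v x))"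
    and "integrable (lebesgue_on \<Omega>) (\<lambda>x. u x \<bullet> v x)"
proof -
  have [measurable]: "u \<in> borel_measurable (lebesgue_on \<Omega>)" "v \<in> borel_measurable (lebesgue_on \<Omega>)"
    using assms by (simp_all add: L2_def)
  have int: "integrable (lebesgue_on \<Omega>) (\<lambda>x. (norm (u x))\<^sup>2 + (norm (v x))\<^sup>2)"
    using assms by (simp add: L2_def)
  have le: "norm (u x) * norm (v x) \<le> (norm (u x))\<^sup>2 + (norm (v x))\<^sup>2" for x
  proof -
    have "0 \<le> norm (u x) * norm (v x)" by simp
    then show ?thesis using sum_squares_bound[of "norm (u x)" "norm (v x)"] by linarith
  qed
  show "integrable (lebesgue_on \<Omega>) (\<lambda>x. norm (u x) * norm (v x))"
    by (rule Bochner_Integration.integrable_bound[OF int]) (use le in auto)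
  show "integrable (lebesgue_on \<Omega>) (\<lambda>x. u x \<bullet> v x)"
    by (rule Bochner_Integration.integrable_bound[OF int])
      (use order_trans[OF Cauchy_Schwarz_ineq2 le] in auto)
qed

lemma L2_linear:
  fixes u v :: "real^'n \<Rightarrow> 'b::euclidean_space"
  assumes "u \<in> L2 \<Omega>" "v \<in> L2 \<Omega>"
  shows "(\<lambda>x. a *\<^sub>R u x + b *\<^sub>R v x) \<in> L2 \<Omega>"
proof -
  have [measurable]: "u \<in> borel_measurable (lebesgue_on \<Omega>)" "v \<in> borel_measurable (lebesgue_on \<Omega>)"
    using assms by (simp_all add: L2_def)
  have "(norm (a *\<^sub>R u x + b *\<^sub>R v x))\<^sup>2 = a\<^sup>2 * (norm (u x))\<^sup>2 + 2 * a * b * (u x \<bullet> v x) + b\<^sup>2 * (norm (v x))\<^sup>2" for x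
    unfolding power2_norm_eq_inner
    by (simp add: inner_add_left inner_add_right inner_commute[of "v x" "u x"] power2_eq_square algebra_simps)
  with assms L2_integrable_inner[OF assms] show ?thesis
    by (auto simp: L2_def)
qed

lemma L2_linear_real:
  fixes u v :: "real^'n \<Rightarrow> real"
  shows "u \<in> L2 \<Omega> \<Longrightarrow> v \<in> L2 \<Omega> \<Longrightarrow> (\<lambda>x. a * u x + b * v x) \<in> L2 \<Omega>"
  using L2_linear[of u \<Omega> v a b] by simp

lemma L2_norm_nonneg: "0 \<le> L2_norm \<Omega> u"
  by (simp add: L2_norm_def)

lemma L2_norm_power2: "(L2_norm \<Omega> u)\<^sup>2 = (LINT x|lebesgue_on \<Omega>. (norm (u x))\<^sup>2)"
  by (simp add: L2_norm_def)

text \<open>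
  The version with norms inside the integral is the one that survives multiplication by a bounded
  matrix field; the bound for the scalar product is a special case.
\<close>

lemma L2_Cauchy_Schwarz_norm:
  fixes u v :: "real^'n \<Rightarrow> 'b::euclidean_space"
  assumes "u \<in> L2 \<Omega>" "v \<in> L2 \<Omega>"
  shows "(LINT x|lebesgue_on \<Omega>. norm (u x) * norm (v x)) \<le> L2_norm \<Omega> u * L2_norm \<Omega> v"
proof -
  have [measurable]: "u \<in> borel_measurable (lebesgue_on \<Omega>)" "v \<in> borel_measurable (lebesgue_on \<Omega>)"
    using assms by (simp_all add: L2_def)
  have sq: "(\<integral>\<^sup>+x. ennreal (norm (w x)) ^ 2 \<partial>lebesgue_on \<Omega>) = ennreal ((L2_norm \<Omega> w)\<^sup>2)"
    if "w \<in> L2 \<Omega>" for w :: "real^'n \<Rightarrow> 'b"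
    using that by (simp add: L2_def L2_norm_power2 ennreal_power nn_integral_eq_integral)
  have "(\<integral>\<^sup>+x. ennreal (norm (u x)) * ennreal (norm (v x)) \<partial>lebesgue_on \<Omega>)
      = ennreal (LINT x|lebesgue_on \<Omega>. norm (u x) * norm (v x))"
    using L2_integrable_inner(1)[OF assms] by (simp add: nn_integral_eq_integral flip: ennreal_mult)
  with Cauchy_Schwarz_nn_integral[of "\<lambda>x. ennreal (norm (u x))" "lebesgue_on \<Omega>" "\<lambda>x. ennreal (norm (v x))"]
  have "(ennreal (LINT x|lebesgue_on \<Omega>. norm (u x) * norm (v x)))\<^sup>2
      \<le> ennreal ((L2_norm \<Omega> u)\<^sup>2) * ennreal ((L2_norm \<Omega> v)\<^sup>2)"
    by (simp add: sq assms)
  then have "(LINT x|lebesgue_on \<Omega>. norm (u x) * norm (v x))\<^sup>2 \<le> (L2_norm \<Omega> u * L2_norm \<Omega> v)\<^sup>2"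
    by (simp add: ennreal_power power_mult_distrib flip: ennreal_mult)
  then show ?thesis
    by (rule power2_le_imp_le) (simp add: L2_norm_nonneg)
qed

lemma L2_inner_le:
  assumes "u \<in> L2 \<Omega>" "v \<in> L2 \<Omega>"
  shows "L2_inner \<Omega> u v \<le> L2_norm \<Omega> u * L2_norm \<Omega> v"
proof -
  have "L2_inner \<Omega> u v \<le> (LINT x|lebesgue_on \<Omega>. norm (u x) * norm (v x))"
    unfolding L2_inner_def
    using L2_integrable_inner[OF assms] by (intro integral_mono) (auto simp flip: abs_mult)
  then show ?thesis using L2_Cauchy_Schwarz_norm[OF assms] by linarith
qed

text \<open>
  A substitute for the triangle inequality: squares are enough wherever only convergence to zero is
  at stake.
\<close>

lemma L2_norm_linear_power2_le:
  fixes u v :: "real^'n \<Rightarrow> 'b::euclidean_space"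
  assumes "u \<in> L2 \<Omega>" "v \<in> L2 \<Omega>"
  shows "(L2_norm \<Omega> (\<lambda>x. a *\<^sub>R u x + b *\<^sub>R v x))\<^sup>2
    \<le> 2 * a\<^sup>2 * (L2_norm \<Omega> u)\<^sup>2 + 2 * b\<^sup>2 * (L2_norm \<Omega> v)\<^sup>2"
proof -
  have "(norm (a *\<^sub>R u x + b *\<^sub>R v x))\<^sup>2 \<le> 2 * a\<^sup>2 * (norm (u x))\<^sup>2 + 2 * b\<^sup>2 * (norm (v x))\<^sup>2" for x
  proof -
    have "(norm (a *\<^sub>R u x + b *\<^sub>R v x))\<^sup>2 \<le> (norm (a *\<^sub>R u x) + norm (b *\<^sub>R v x))\<^sup>2"
      by (intro power_mono norm_triangle_ineq) simp
    also have "\<dots> \<le> 2 * (norm (a *\<^sub>R u x))\<^sup>2 + 2 * (norm (b *\<^sub>R v x))\<^sup>2"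
      using sum_squares_bound[of "norm (a *\<^sub>R u x)" "norm (b *\<^sub>R v x)"] by (simp add: power2_sum)
    finally show ?thesis by (simp add: power_mult_distrib)
  qed
  then have "(LINT x|lebesgue_on \<Omega>. (norm (a *\<^sub>R u x + b *\<^sub>R v x))\<^sup>2)
      \<le> (LINT x|lebesgue_on \<Omega>. 2 * a\<^sup>2 * (norm (u x))\<^sup>2 + 2 * b\<^sup>2 * (norm (v x))\<^sup>2)"
    using assms L2_linear[OF assms, of a b] by (intro integral_mono) (simp_all add: L2_def)
  also have "\<dots> = 2 * a\<^sup>2 * (L2_norm \<Omega> u)\<^sup>2 + 2 * b\<^sup>2 * (L2_norm \<Omega> v)\<^sup>2"
    using assms by (simp add: L2_def L2_norm_power2)
  finally show ?thesis by (simp only: L2_norm_power2)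
qed

lemma integrable_mult_bounded:
  fixes f :: "_ \<Rightarrow> real"
  assumes "integrable M f" "\<phi> \<in> borel_measurable M" "\<And>x. x \<in> space M \<Longrightarrow> \<bar>\<phi> x\<bar> \<le> K"
  shows "integrable M (\<lambda>x. f x * \<phi> x)"
proof (rule Bochner_Integration.integrable_bound)
  show "integrable M (\<lambda>x. K * f x)" using assms(1) by simp
  show "AE x in M. norm (f x * \<phi> x) \<le> norm (K * f x)"
  proof (rule AE_I2)
    fix x assume "x \<in> space M"
    then have "\<bar>\<phi> x\<bar> \<le> \<bar>K\<bar>" using assms(3)[of x] by linarith
    then show "norm (f x * \<phi> x) \<le> norm (K * f x)"
      by (simp add: abs_mult mult.commute[of "\<bar>f x\<bar>"] mult_right_mono)
  qed
qed (use assms in measurable)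

lemma eq_ae_refl: "eq_ae \<Omega> u u"
  and eq_ae_sym: "eq_ae \<Omega> u v \<Longrightarrow> eq_ae \<Omega> v u"
  by (auto simp: eq_ae_def)

lemma eq_ae_trans:
  assumes "eq_ae \<Omega> u v" "eq_ae \<Omega> v w"
  shows "eq_ae \<Omega> u w"
  using assms unfolding eq_ae_def by eventually_elim simp

lemma eq_ae_linear:
  assumes "eq_ae \<Omega> u u'" "eq_ae \<Omega> v v'"
  shows "eq_ae \<Omega> (\<lambda>x. a * u x + b * v x) (\<lambda>x. a * u' x + b * v' x)"
  using assms unfolding eq_ae_def by eventually_elim simp

section \<open>Uniqueness and linearity of the weak gradient\<close>

text \<open>
  Boundedness makes square integrable functions integrable, so that all the integrals against test
  functions exist; openness is what makes weak gradients unique.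
\<close>

locale bounded_open_set =
  fixes \<Omega> :: "(real^'n) set"
  assumes open_\<Omega>: "open \<Omega>" and bounded_\<Omega>: "bounded \<Omega>"
begin

lemma lmeasurable_\<Omega>: "\<Omega> \<in> lmeasurable"
  using open_\<Omega> bounded_\<Omega> lmeasurable_open by blast

lemma sets_\<Omega> [simp]: "\<Omega> \<in> sets lebesgue"
  using lmeasurable_\<Omega> by (rule fmeasurableD)

lemma measurable_cong_ae:
  fixes u v :: "real^'n \<Rightarrow> 'b::euclidean_space"
  assumes u: "u \<in> borel_measurable (lebesgue_on \<Omega>)" and ae: "eq_ae \<Omega> u v"
  shows "v \<in> borel_measurable (lebesgue_on \<Omega>)"
proof -
  have "AE x in lebesgue. (if x \<in> \<Omega> then u x else 0) = (if x \<in> \<Omega> then v x else 0)"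
    using ae unfolding eq_ae_def by (subst (asm) AE_restrict_space_iff) auto
  moreover have "(\<lambda>x. if x \<in> \<Omega> then u x else 0) \<in> borel_measurable lebesgue"
    using u by (simp add: borel_measurable_if)
  ultimately have "(\<lambda>x. if x \<in> \<Omega> then v x else 0) \<in> borel_measurable lebesgue"
    by (rule borel_measurable_AE[rotated])
  then show ?thesis by (simp add: borel_measurable_if)
qed

lemma L2_cong_ae:
  fixes u v :: "real^'n \<Rightarrow> 'b::euclidean_space"
  assumes u: "u \<in> L2 \<Omega>" and ae: "eq_ae \<Omega> u v"
  shows "v \<in> L2 \<Omega>" and "L2_norm \<Omega> v = L2_norm \<Omega> u"
proof -
  have [measurable]: "u \<in> borel_measurable (lebesgue_on \<Omega>)" "v \<in> borel_measurable (lebesgue_on \<Omega>)"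
    using u measurable_cong_ae[OF _ ae] by (simp_all add: L2_def)
  have ae': "AE x in lebesgue_on \<Omega>. (norm (u x))\<^sup>2 = (norm (v x))\<^sup>2"
    using ae unfolding eq_ae_def by eventually_elim simp
  have "integrable (lebesgue_on \<Omega>) (\<lambda>x. (norm (u x))\<^sup>2) \<longleftrightarrow> integrable (lebesgue_on \<Omega>) (\<lambda>x. (norm (v x))\<^sup>2)"
    by (rule integrable_cong_AE) (use ae' in auto)
  with u show "v \<in> L2 \<Omega>" by (simp add: L2_def)
  have "(LINT x|lebesgue_on \<Omega>. (norm (u x))\<^sup>2) = (LINT x|lebesgue_on \<Omega>. (norm (v x))\<^sup>2)"
    by (rule integral_cong_AE) (use ae' in auto)
  then show "L2_norm \<Omega> v = L2_norm \<Omega> u" by (simp add: L2_norm_def)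
qed

lemma L2_imp_integrable:
  fixes u :: "real^'n \<Rightarrow> 'b::euclidean_space"
  assumes "u \<in> L2 \<Omega>"
  shows "integrable (lebesgue_on \<Omega>) u"
proof -
  interpret finite_measure "lebesgue_on \<Omega>"
    by (rule finite_measure_lebesgue_on[OF lmeasurable_\<Omega>])
  have "integrable (lebesgue_on \<Omega>) (\<lambda>x. 1 + (norm (u x))\<^sup>2)"
    using assms by (simp add: L2_def)
  moreover have "norm (u x) \<le> norm (1 + (norm (u x))\<^sup>2)" for x
  proof -
    have "norm (u x) \<le> 2 * 1 * norm (u x)" by simp
    also have "\<dots> \<le> 1\<^sup>2 + (norm (u x))\<^sup>2" by (rule sum_squares_bound)
    also have "\<dots> = norm (1 + (norm (u x))\<^sup>2)" by simp
    finally show ?thesis .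
  qed
  moreover have "u \<in> borel_measurable (lebesgue_on \<Omega>)" using assms by (rule L2_measurable)
  ultimately show ?thesis
    by (intro Bochner_Integration.integrable_bound[of "lebesgue_on \<Omega>" "\<lambda>x. 1 + (norm (u x))\<^sup>2" u] AE_I2)
qed

lemma continuous_measurable:
  fixes \<psi> :: "real^'n \<Rightarrow> real"
  assumes "continuous_on UNIV \<psi>"
  shows "\<psi> \<in> borel_measurable (lebesgue_on \<Omega>)"
  by (rule continuous_imp_measurable_on_sets_lebesgue[OF continuous_on_subset[OF assms] sets_\<Omega>]) simp

lemma integrable_mult_continuous:
  fixes \<psi> :: "real^'n \<Rightarrow> real"
  assumes f: "integrable (lebesgue_on \<Omega>) f" and \<psi>: "continuous_on UNIV \<psi>"
  shows "integrable (lebesgue_on \<Omega>) (\<lambda>x. f x * \<psi> x)"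
proof -
  have "bounded (\<psi> ` closure \<Omega>)"
    using bounded_\<Omega> continuous_on_subset[OF \<psi>]
    by (intro compact_imp_bounded compact_continuous_image) auto
  then obtain K where K: "\<And>x. x \<in> closure \<Omega> \<Longrightarrow> \<bar>\<psi> x\<bar> \<le> K"
    by (auto simp: bounded_iff)
  then show ?thesis
    by (intro integrable_mult_bounded[of _ _ _ K] f continuous_measurable[OF \<psi>] K)
      (simp add: closure_def)
qed

lemma test_function_continuous:
  assumes "\<phi> \<in> test_functions \<Omega>"
  shows "continuous_on UNIV \<phi>"
    and "continuous_on UNIV (\<lambda>x. frechet_derivative \<phi> (at x) (axis i 1))"
proof -
  have Ck: "Ck 0 \<phi>" "Ck 1 \<phi>" using assms unfolding test_functions_def smooth_def by blast+
  from Ck(1) show "continuous_on UNIV \<phi>" by simp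
  obtain D where D: "\<forall>i. continuous_on UNIV (D i)"
    "\<And>x. (\<phi> has_derivative (\<lambda>h. \<Sum>i\<in>UNIV. h $ i * D i x)) (at x)"
    using Ck(2) by auto
  have "frechet_derivative \<phi> (at x) (axis i 1) = D i x" for x
  proof -
    have "frechet_derivative \<phi> (at x) (axis i 1) = (\<Sum>j\<in>UNIV. axis i 1 $ j * D j x)"
      using fun_cong[OF frechet_derivative_at[OF D(2)[of x]], of "axis i 1"] by simp
    also have "\<dots> = D i x"
      by (simp add: axis_def if_distrib if_distribR cong: if_cong)
    finally show ?thesis .
  qed
  with D(1) show "continuous_on UNIV (\<lambda>x. frechet_derivative \<phi> (at x) (axis i 1))" by simp
qed

lemma weak_gradient_linear:
  assumes "u \<in> L2 \<Omega>" "v \<in> L2 \<Omega>" "g \<in> L2 \<Omega>" "h \<in> L2 \<Omega>"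
    and "weak_gradient \<Omega> u g" "weak_gradient \<Omega> v h"
  shows "weak_gradient \<Omega> (\<lambda>x. a * u x + b * v x) (\<lambda>x. a *\<^sub>R g x + b *\<^sub>R h x)"
  unfolding weak_gradient_def
proof (intro ballI allI)
  fix \<phi> i assume \<phi>: "\<phi> \<in> test_functions \<Omega>"
  note c = test_function_continuous[OF \<phi>]
  have nth: "integrable (lebesgue_on \<Omega>) (\<lambda>x. f x $ i)" if "f \<in> L2 \<Omega>" for f :: "real^'n \<Rightarrow> real^'n"
    using L2_imp_integrable[OF that] by (rule integrable_bounded_linear[OF bounded_linear_vec_nth])
  have "(LINT x|lebesgue_on \<Omega>. (a * u x + b * v x) * frechet_derivative \<phi> (at x) (axis i 1))
     = a * (LINT x|lebesgue_on \<Omega>. u x * frechet_derivative \<phi> (at x) (axis i 1))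
     + b * (LINT x|lebesgue_on \<Omega>. v x * frechet_derivative \<phi> (at x) (axis i 1))"
    using assms(1,2) c by (simp add: distrib_right mult.assoc L2_imp_integrable integrable_mult_continuous)
  also have "\<dots> = - (a * (LINT x|lebesgue_on \<Omega>. g x $ i * \<phi> x) + b * (LINT x|lebesgue_on \<Omega>. h x $ i * \<phi> x))"
    using assms(5,6) \<phi> unfolding weak_gradient_def by simp
  also have "\<dots> = - (LINT x|lebesgue_on \<Omega>. (a *\<^sub>R g x + b *\<^sub>R h x) $ i * \<phi> x)"
    using assms(3,4) c by (simp add: distrib_right mult.assoc nth integrable_mult_continuous)
  finally show "(LINT x|lebesgue_on \<Omega>. (a * u x + b * v x) * frechet_derivative \<phi> (at x) (axis i 1))
    = - (LINT x|lebesgue_on \<Omega>. (a *\<^sub>R g x + b *\<^sub>R h x) $ i * \<phi> x)" .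
qed

lemma weak_gradient_cong_ae:
  assumes "u \<in> L2 \<Omega>" "eq_ae \<Omega> u v" "weak_gradient \<Omega> u g"
  shows "weak_gradient \<Omega> v g"
proof -
  have [measurable]: "u \<in> borel_measurable (lebesgue_on \<Omega>)" "v \<in> borel_measurable (lebesgue_on \<Omega>)"
    using assms measurable_cong_ae[OF _ assms(2)] by (simp_all add: L2_def)
  have "(LINT x|lebesgue_on \<Omega>. u x * frechet_derivative \<phi> (at x) (axis i 1))
      = (LINT x|lebesgue_on \<Omega>. v x * frechet_derivative \<phi> (at x) (axis i 1))" if "\<phi> \<in> test_functions \<Omega>" for \<phi> i
  proof (rule integral_cong_AE)
    have [measurable]: "(\<lambda>x. frechet_derivative \<phi> (at x) (axis i 1)) \<in> borel_measurable (lebesgue_on \<Omega>)"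
      by (rule continuous_measurable[OF test_function_continuous(2)[OF that]])
    show "(\<lambda>x. u x * frechet_derivative \<phi> (at x) (axis i 1)) \<in> borel_measurable (lebesgue_on \<Omega>)"
      "(\<lambda>x. v x * frechet_derivative \<phi> (at x) (axis i 1)) \<in> borel_measurable (lebesgue_on \<Omega>)"
      by measurable
    show "AE x in lebesgue_on \<Omega>. u x * frechet_derivative \<phi> (at x) (axis i 1) =
        v x * frechet_derivative \<phi> (at x) (axis i 1)"
      using assms(2) unfolding eq_ae_def by eventually_elim simp
  qed
  with assms(3) show ?thesis unfolding weak_gradient_def by simp
qed

text \<open>
  The components of the difference of two weak gradients are annihilated by all test functions.
\<close>

lemma weak_gradient_unique:
  assumes "g \<in> L2 \<Omega>" "h \<in> L2 \<Omega>" "weak_gradient \<Omega> u g" "weak_gradient \<Omega> u h"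
  shows "eq_ae \<Omega> g h"
proof -
  have nth: "integrable (lebesgue_on \<Omega>) (\<lambda>x. f x $ i)" if "f \<in> L2 \<Omega>" for f :: "real^'n \<Rightarrow> real^'n" and i
    using L2_imp_integrable[OF that] by (rule integrable_bounded_linear[OF bounded_linear_vec_nth])
  have "AE x in lebesgue_on \<Omega>. g x $ i - h x $ i = 0" for i
  proof (rule fundamental_lemma_of_variations[OF open_\<Omega>])
    fix \<phi> assume \<phi>: "\<phi> \<in> test_functions \<Omega>"
    have "(LINT x|lebesgue_on \<Omega>. g x $ i * \<phi> x) = (LINT x|lebesgue_on \<Omega>. h x $ i * \<phi> x)"
    proof -
      have "- (LINT x|lebesgue_on \<Omega>. g x $ i * \<phi> x) = - (LINT x|lebesgue_on \<Omega>. h x $ i * \<phi> x)"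
        using assms(3)[unfolded weak_gradient_def, rule_format, OF \<phi>, of i]
          assms(4)[unfolded weak_gradient_def, rule_format, OF \<phi>, of i] by (rule trans[OF sym])
      then show ?thesis by (simp only: neg_equal_iff_equal)
    qed
    then show "(LINT x|lebesgue_on \<Omega>. (g x $ i - h x $ i) * \<phi> x) = 0"
      using assms(1,2) test_function_continuous(1)[OF \<phi>]
      by (simp add: left_diff_distrib nth integrable_mult_continuous)
  qed (use nth[OF assms(1)] nth[OF assms(2)] in simp)
  then have "AE x in lebesgue_on \<Omega>. \<forall>i. g x $ i - h x $ i = 0"
    by (simp add: AE_all_countable)
  then show ?thesis unfolding eq_ae_def by eventually_elim (simp add: vec_eq_iff)
qed

lemma H1_grad:
  assumes "u \<in> H1 \<Omega>"
  shows "u \<in> L2 \<Omega>" "grad \<Omega> u \<in> L2 \<Omega>" "weak_gradient \<Omega> u (grad \<Omega> u)"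
proof -
  have "\<exists>g. g \<in> L2 \<Omega> \<and> weak_gradient \<Omega> u g" using assms by (auto simp: H1_def)
  from someI_ex[OF this] show "grad \<Omega> u \<in> L2 \<Omega>" "weak_gradient \<Omega> u (grad \<Omega> u)"
    by (simp_all add: grad_def)
qed (use assms in \<open>simp add: H1_def\<close>)

text \<open>
  The gradient is picked by a choice operator, so it is linear only almost everywhere, and only
  because of uniqueness.  Stating this for every \<open>w\<close> that agrees almost everywhere with the linear
  combination also covers the change of representative.
\<close>

lemma H1_linear_ae:
  assumes u: "u \<in> H1 \<Omega>" and v: "v \<in> H1 \<Omega>" and w: "eq_ae \<Omega> w (\<lambda>x. a * u x + b * v x)"
  shows "w \<in> H1 \<Omega>"
    and "eq_ae \<Omega> (grad \<Omega> w) (\<lambda>x. a *\<^sub>R grad \<Omega> u x + b *\<^sub>R grad \<Omega> v x)"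
proof -
  note w' = eq_ae_sym[OF w]
  have uv: "(\<lambda>x. a * u x + b * v x) \<in> L2 \<Omega>" "(\<lambda>x. a *\<^sub>R grad \<Omega> u x + b *\<^sub>R grad \<Omega> v x) \<in> L2 \<Omega>"
    by (intro L2_linear_real L2_linear H1_grad u v)+
  have wg: "weak_gradient \<Omega> w (\<lambda>x. a *\<^sub>R grad \<Omega> u x + b *\<^sub>R grad \<Omega> v x)"
    using u v by (intro weak_gradient_cong_ae[OF uv(1) w'] weak_gradient_linear H1_grad)
  show *: "w \<in> H1 \<Omega>"
    using L2_cong_ae(1)[OF uv(1) w'] uv(2) wg by (auto simp: H1_def)
  show "eq_ae \<Omega> (grad \<Omega> w) (\<lambda>x. a *\<^sub>R grad \<Omega> u x + b *\<^sub>R grad \<Omega> v x)"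
    using weak_gradient_unique[OF H1_grad(2)[OF *] uv(2) H1_grad(3)[OF *] wg] .
qed

lemma H1_linear: "u \<in> H1 \<Omega> \<Longrightarrow> v \<in> H1 \<Omega> \<Longrightarrow> (\<lambda>x. a * u x + b * v x) \<in> H1 \<Omega>"
  by (erule (1) H1_linear_ae(1)) (rule eq_ae_refl)

lemma H1_norm_linear_power2_le:
  assumes "u \<in> H1 \<Omega>" "v \<in> H1 \<Omega>"
  shows "(H1_norm \<Omega> (\<lambda>x. a * u x + b * v x))\<^sup>2
    \<le> 2 * a\<^sup>2 * (H1_norm \<Omega> u)\<^sup>2 + 2 * b\<^sup>2 * (H1_norm \<Omega> v)\<^sup>2"
proof -
  have "L2_norm \<Omega> (grad \<Omega> (\<lambda>x. a * u x + b * v x)) = L2_norm \<Omega> (\<lambda>x. a *\<^sub>R grad \<Omega> u x + b *\<^sub>R grad \<Omega> v x)"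
    by (intro L2_cong_ae(2) L2_linear H1_grad assms eq_ae_sym[OF H1_linear_ae(2)] eq_ae_refl)
  with L2_norm_linear_power2_le[of u \<Omega> v a b] L2_norm_linear_power2_le[of "grad \<Omega> u" \<Omega> "grad \<Omega> v" a b]
  show ?thesis
    using assms H1_grad by (simp add: H1_norm_def distrib_left)
qed

end

section \<open>Linearity of the trace condition and of the finite element space\<close>

text \<open>
  The surface measure is built on the Borel sets, so continuous functions are measurable for it.
  This is what allows the boundary integrals below to be split.
\<close>

lemma borel_measurable_surface_measure:
  fixes f :: "real^'n \<Rightarrow> real"
  assumes "continuous_on UNIV f"
  shows "f \<in> borel_measurable (restrict_space surface_measure S)"
proof -
  have "sets (surface_measure :: (real^'n) measure) = sets borel"
    unfolding surface_measure_def
    using sets.sigma_sets_eq[of "borel :: (real^'n) measure"] by (subst sets_measure_of) auto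
  then have "f \<in> borel_measurable surface_measure"
    using borel_measurable_continuous_onI[OF assms] measurable_cong_sets by blast
  then show ?thesis by (rule measurable_restrict_space1)
qed

context bounded_open_set
begin

text \<open>
  The linear combinations of the two approximating sequences approximate the linear combination,
  both in \<open>H1\<close> and on the boundary, since the squared errors add up to a factor of two.
\<close>

lemma has_trace_linear:
  assumes u: "u \<in> H1 \<Omega>" "has_trace \<Omega> u g" and v: "v \<in> H1 \<Omega>" "has_trace \<Omega> v h"
  shows "has_trace \<Omega> (\<lambda>x. a * u x + b * v x) (\<lambda>x. a * g x + b * h x)"
proof -
  let ?M = "restrict_space surface_measure (frontier \<Omega>)"
  obtain \<phi> where \<phi>: "\<And>k. smooth (\<phi> k)" "\<And>k. \<phi> k \<in> H1 \<Omega>"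
    "(\<lambda>k. H1_norm \<Omega> (\<lambda>x. \<phi> k x - u x)) \<longlonglongrightarrow> 0"
    "(\<lambda>k. \<integral>\<^sup>+ x. ennreal ((\<phi> k x - g x)\<^sup>2) \<partial>?M) \<longlonglongrightarrow> 0"
    using u(2) unfolding has_trace_def by blast
  obtain \<psi> where \<psi>: "\<And>k. smooth (\<psi> k)" "\<And>k. \<psi> k \<in> H1 \<Omega>"
    "(\<lambda>k. H1_norm \<Omega> (\<lambda>x. \<psi> k x - v x)) \<longlonglongrightarrow> 0"
    "(\<lambda>k. \<integral>\<^sup>+ x. ennreal ((\<psi> k x - h x)\<^sup>2) \<partial>?M) \<longlonglongrightarrow> 0"
    using v(2) unfolding has_trace_def by blast
  have [measurable]: "g \<in> borel_measurable ?M" "h \<in> borel_measurable ?M"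
    using u(2) v(2) by (auto simp: has_trace_def)
  have [measurable]: "\<phi> k \<in> borel_measurable ?M" "\<psi> k \<in> borel_measurable ?M" for k
    using \<phi>(1)[of k] \<psi>(1)[of k] unfolding smooth_def
    by (auto intro!: borel_measurable_surface_measure dest: spec[of _ 0])
  let ?\<chi> = "\<lambda>k x. a * \<phi> k x + b * \<psi> k x"
  have "(\<lambda>k. H1_norm \<Omega> (\<lambda>x. ?\<chi> k x - (a * u x + b * v x))) \<longlonglongrightarrow> 0"
  proof -
    have H1: "(\<lambda>x. \<phi> k x - u x) \<in> H1 \<Omega>" "(\<lambda>x. \<psi> k x - v x) \<in> H1 \<Omega>" for k
      using H1_linear[OF \<phi>(2)[of k] u(1), of 1 "-1"] H1_linear[OF \<psi>(2)[of k] v(1), of 1 "-1"] by simp_all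
    let ?s = "\<lambda>k. 2 * a\<^sup>2 * (H1_norm \<Omega> (\<lambda>x. \<phi> k x - u x))\<^sup>2 + 2 * b\<^sup>2 * (H1_norm \<Omega> (\<lambda>x. \<psi> k x - v x))\<^sup>2"
    have "(H1_norm \<Omega> (\<lambda>x. ?\<chi> k x - (a * u x + b * v x)))\<^sup>2 \<le> ?s k" for k
      using H1_norm_linear_power2_le[OF H1, of a k b k] by (simp add: algebra_simps)
    then have le: "H1_norm \<Omega> (\<lambda>x. ?\<chi> k x - (a * u x + b * v x)) \<le> sqrt (?s k)" for k
      by (rule real_le_rsqrt)
    have "(\<lambda>k. sqrt (?s k)) \<longlonglongrightarrow> sqrt (2 * a\<^sup>2 * 0\<^sup>2 + 2 * b\<^sup>2 * 0\<^sup>2)"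
      by (intro tendsto_intros \<phi>(3) \<psi>(3))
    then have lim: "(\<lambda>k. sqrt (?s k)) \<longlonglongrightarrow> 0" by simp
    show ?thesis
    proof (rule real_tendsto_sandwich[OF _ _ tendsto_const lim])
      show "eventually (\<lambda>k. 0 \<le> H1_norm \<Omega> (\<lambda>x. ?\<chi> k x - (a * u x + b * v x))) sequentially"
        by (simp add: H1_norm_def)
      show "eventually (\<lambda>k. H1_norm \<Omega> (\<lambda>x. ?\<chi> k x - (a * u x + b * v x)) \<le> sqrt (?s k)) sequentially"
        by (intro always_eventually allI le)
    qed
  qed
  moreover have "(\<lambda>k. \<integral>\<^sup>+ x. ennreal ((?\<chi> k x - (a * g x + b * h x))\<^sup>2) \<partial>?M) \<longlonglongrightarrow> 0"
  proof -
    let ?s = "\<lambda>k. ennreal (2 * a\<^sup>2) * (\<integral>\<^sup>+ x. ennreal ((\<phi> k x - g x)\<^sup>2) \<partial>?M)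
        + ennreal (2 * b\<^sup>2) * (\<integral>\<^sup>+ x. ennreal ((\<psi> k x - h x)\<^sup>2) \<partial>?M)"
    have le: "(\<integral>\<^sup>+ x. ennreal ((?\<chi> k x - (a * g x + b * h x))\<^sup>2) \<partial>?M) \<le> ?s k" for k
    proof -
      have *: "(a * (\<phi> k x - g x) + b * (\<psi> k x - h x))\<^sup>2
          \<le> 2 * a\<^sup>2 * (\<phi> k x - g x)\<^sup>2 + 2 * b\<^sup>2 * (\<psi> k x - h x)\<^sup>2" for x
        using sum_squares_bound[of "a * (\<phi> k x - g x)" "b * (\<psi> k x - h x)"]
        by (simp add: power2_sum power_mult_distrib)
      have "ennreal ((?\<chi> k x - (a * g x + b * h x))\<^sup>2) \<le>
          ennreal (2 * a\<^sup>2) * ennreal ((\<phi> k x - g x)\<^sup>2) + ennreal (2 * b\<^sup>2) * ennreal ((\<psi> k x - h x)\<^sup>2)" for x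
      proof -
        have "?\<chi> k x - (a * g x + b * h x) = a * (\<phi> k x - g x) + b * (\<psi> k x - h x)"
          by (simp add: right_diff_distrib)
        then have "ennreal ((?\<chi> k x - (a * g x + b * h x))\<^sup>2)
            \<le> ennreal (2 * a\<^sup>2 * (\<phi> k x - g x)\<^sup>2 + 2 * b\<^sup>2 * (\<psi> k x - h x)\<^sup>2)"
          using *[of x] by (simp only: ennreal_leI)
        also have "\<dots> = ennreal (2 * a\<^sup>2) * ennreal ((\<phi> k x - g x)\<^sup>2)
            + ennreal (2 * b\<^sup>2) * ennreal ((\<psi> k x - h x)\<^sup>2)"
          by (simp add: ennreal_mult)
        finally show ?thesis .
      qed
      then have "(\<integral>\<^sup>+ x. ennreal ((?\<chi> k x - (a * g x + b * h x))\<^sup>2) \<partial>?M) \<le>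
        (\<integral>\<^sup>+ x. ennreal (2 * a\<^sup>2) * ennreal ((\<phi> k x - g x)\<^sup>2) + ennreal (2 * b\<^sup>2) * ennreal ((\<psi> k x - h x)\<^sup>2) \<partial>?M)"
        by (intro nn_integral_mono)
      also have "\<dots> = ?s k"
        by (subst nn_integral_add; measurable) (simp add: nn_integral_cmult)
      finally show ?thesis .
    qed
    have "?s \<longlonglongrightarrow> ennreal (2 * a\<^sup>2) * 0 + ennreal (2 * b\<^sup>2) * 0"
      by (intro tendsto_add ennreal_tendsto_cmult \<phi>(4) \<psi>(4)) simp_all
    then have lim: "?s \<longlonglongrightarrow> 0" by simp
    show ?thesis
    proof (rule tendsto_sandwich[OF _ _ tendsto_const lim])
      show "eventually (\<lambda>k. (\<integral>\<^sup>+ x. ennreal ((?\<chi> k x - (a * g x + b * h x))\<^sup>2) \<partial>?M) \<le> ?s k) sequentially"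
        by (intro always_eventually allI le)
    qed simp
  qed
  moreover have "(\<lambda>x. a * g x + b * h x) \<in> borel_measurable ?M" by measurable
  ultimately show ?thesis
    unfolding has_trace_def using smooth_linear[OF \<phi>(1) \<psi>(1)] H1_linear[OF \<phi>(2) \<psi>(2)]
    by (intro conjI exI[of _ ?\<chi>]) auto
qed

lemma H1_zero_on_linear:
  assumes "u \<in> H1_zero_on \<Omega> \<Gamma>" "v \<in> H1_zero_on \<Omega> \<Gamma>"
  shows "(\<lambda>x. a * u x + b * v x) \<in> H1_zero_on \<Omega> \<Gamma>"
proof -
  obtain g where g: "has_trace \<Omega> u g" "AE x in surface_measure. x \<in> \<Gamma> \<longrightarrow> g x = 0"
    using assms(1) by (auto simp: H1_zero_on_def)
  obtain h where h: "has_trace \<Omega> v h" "AE x in surface_measure. x \<in> \<Gamma> \<longrightarrow> h x = 0"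
    using assms(2) by (auto simp: H1_zero_on_def)
  have H1: "u \<in> H1 \<Omega>" "v \<in> H1 \<Omega>" using assms by (auto simp: H1_zero_on_def)
  have "AE x in surface_measure. x \<in> \<Gamma> \<longrightarrow> a * g x + b * h x = 0"
    using g(2) h(2) by eventually_elim simp
  then show ?thesis
    unfolding H1_zero_on_def mem_Collect_eq
    by (intro conjI exI[of _ "\<lambda>x. a * g x + b * h x"] H1_linear H1 has_trace_linear g h)
qed

end

lemma H1_zero_on_subset_H1: "H1_zero_on \<Omega> \<Gamma> \<subseteq> H1 \<Omega>"
  by (auto simp: H1_zero_on_def)

lemma fe_space_subset: "fe_space \<Omega> \<Gamma> k \<T> \<subseteq> H1_zero_on \<Omega> \<Gamma>"
  by (auto simp: fe_space_def)

lemma shape_functions_linear: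
  assumes "p \<in> shape_functions k" "q \<in> shape_functions k"
  shows "(\<lambda>x. a * p x + b * q x) \<in> shape_functions k"
proof (cases k)
  case P1
  obtain a1 b1 a2 b2 where "p = (\<lambda>x. a1 + b1 \<bullet> x)" "q = (\<lambda>x. a2 + b2 \<bullet> x)"
    using assms P1 by auto
  then have "(\<lambda>x. a * p x + b * q x) = (\<lambda>x. (a * a1 + b * a2) + (a *\<^sub>R b1 + b *\<^sub>R b2) \<bullet> x)"
    by (auto simp: inner_add_left algebra_simps)
  with P1 show ?thesis by auto
next
  case Q1
  obtain c d where "p = (\<lambda>x. \<Sum>S\<in>UNIV. c S * (\<Prod>i\<in>S. x $ i))" "q = (\<lambda>x. \<Sum>S\<in>UNIV. d S * (\<Prod>i\<in>S. x $ i))"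
    using assms Q1 by auto
  then have "(\<lambda>x. a * p x + b * q x) = (\<lambda>x. \<Sum>S\<in>UNIV. (a * c S + b * d S) * (\<Prod>i\<in>S. x $ i))"
    by (auto simp: sum_distrib_left sum.distrib algebra_simps)
  with Q1 show ?thesis by (auto intro!: exI[of _ "\<lambda>S. a * c S + b * d S"])
qed

lemma (in bounded_open_set) fe_space_linear:
  assumes u: "u \<in> fe_space \<Omega> \<Gamma> k \<T>" and v: "v \<in> fe_space \<Omega> \<Gamma> k \<T>"
  shows "(\<lambda>x. a * u x + b * v x) \<in> fe_space \<Omega> \<Gamma> k \<T>"
proof -
  obtain g where g: "eq_ae \<Omega> u g" "continuous_on (closure \<Omega>) g"
    "\<And>F. F \<in> \<T> \<Longrightarrow> \<exists>p\<in>shape_functions k. \<forall>x\<in>ref_element k. g (F x) = p x"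
    using u unfolding fe_space_def by blast
  obtain h where h: "eq_ae \<Omega> v h" "continuous_on (closure \<Omega>) h"
    "\<And>F. F \<in> \<T> \<Longrightarrow> \<exists>p\<in>shape_functions k. \<forall>x\<in>ref_element k. h (F x) = p x"
    using v unfolding fe_space_def by blast
  have "\<exists>p\<in>shape_functions k. \<forall>x\<in>ref_element k. a * g (F x) + b * h (F x) = p x" if F: "F \<in> \<T>" for F
  proof -
    obtain p q where "p \<in> shape_functions k" "\<forall>x\<in>ref_element k. g (F x) = p x"
      "q \<in> shape_functions k" "\<forall>x\<in>ref_element k. h (F x) = q x"
      using g(3)[OF F] h(3)[OF F] by blast
    then show ?thesis
      by (intro bexI[of _ "\<lambda>x. a * p x + b * q x"] shape_functions_linear) auto
  qed
  moreover have "continuous_on (closure \<Omega>) (\<lambda>x. a * g x + b * h x)"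
    by (intro continuous_intros g h)
  moreover have "(\<lambda>x. a * u x + b * v x) \<in> H1_zero_on \<Omega> \<Gamma>"
    using u v by (intro H1_zero_on_linear subsetD[OF fe_space_subset])
  ultimately show ?thesis
    using eq_ae_linear[OF g(1) h(1), of a b]
    by (auto simp: fe_space_def intro!: exI[of _ "\<lambda>x. a * g x + b * h x"])
qed

section \<open>The energy form\<close>

locale elliptic_coefficient = bounded_open_set +
  fixes A :: "real^'n \<Rightarrow> real^'n^'n" and \<alpha> \<beta> :: real
  assumes coefficient_A: "coefficient \<Omega> \<alpha> \<beta> A"
begin

lemma measurable_matrix_vector:
  assumes "g \<in> borel_measurable (lebesgue_on \<Omega>)"
  shows "(\<lambda>x. A x *v g x) \<in> borel_measurable (lebesgue_on \<Omega>)"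
proof -
  have "bilinear ((*v) :: real^'n^'n \<Rightarrow> real^'n \<Rightarrow> real^'n)"
    unfolding bilinear_def
    by (intro conjI allI linearI)
      (rule matrix_vector_mult_add_rdistrib matrix_vector_right_distrib
        matrix_vector_mult_scaleR scaleR_matrix_vector_assoc[symmetric])+
  then show ?thesis
    by (rule borel_measurable_bilinear[OF _ _ assms sets_\<Omega>])
      (use coefficient_A in \<open>simp add: coefficient_def\<close>)
qed

lemma energy_integrable:
  assumes "g \<in> L2 \<Omega>" "h \<in> L2 \<Omega>"
  shows "integrable (lebesgue_on \<Omega>) (\<lambda>x. (A x *v g x) \<bullet> h x)"
proof (rule Bochner_Integration.integrable_bound)
  show "integrable (lebesgue_on \<Omega>) (\<lambda>x. \<beta> * (norm (g x) * norm (h x)))"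
    using L2_integrable_inner(1)[OF assms] by simp
  show "(\<lambda>x. (A x *v g x) \<bullet> h x) \<in> borel_measurable (lebesgue_on \<Omega>)"
    by (rule borel_measurable_inner[OF measurable_matrix_vector[OF L2_measurable[OF assms(1)]]
          L2_measurable[OF assms(2)]])
  have "AE x in lebesgue_on \<Omega>. \<forall>\<xi>. norm (A x *v \<xi>) \<le> \<beta> * norm \<xi>"
    using coefficient_A unfolding coefficient_def by auto
  then show "AE x in lebesgue_on \<Omega>. norm ((A x *v g x) \<bullet> h x) \<le> norm (\<beta> * (norm (g x) * norm (h x)))"
  proof eventually_elim
    case (elim x)
    have "norm ((A x *v g x) \<bullet> h x) \<le> norm (A x *v g x) * norm (h x)"
      by (simp add: Cauchy_Schwarz_ineq2)
    also have "\<dots> \<le> (\<beta> * norm (g x)) * norm (h x)"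
      using elim by (intro mult_right_mono) auto
    also have "\<dots> \<le> norm (\<beta> * (norm (g x) * norm (h x)))"
      unfolding real_norm_def mult.assoc by (rule abs_ge_self)
    finally show ?case .
  qed
qed

lemma energy_form_sym:
  assumes "u \<in> H1 \<Omega>" "v \<in> H1 \<Omega>"
  shows "energy_form \<Omega> A u v = energy_form \<Omega> A v u"
  unfolding energy_form_def
proof (rule integral_cong_AE)
  have "AE x in lebesgue_on \<Omega>. transpose (A x) = A x"
    using coefficient_A by (simp add: coefficient_def)
  then show "AE x in lebesgue_on \<Omega>. (A x *v grad \<Omega> u x) \<bullet> grad \<Omega> v x = (A x *v grad \<Omega> v x) \<bullet> grad \<Omega> u x"
  proof eventually_elim
    case (elim x)
    have "(A x *v grad \<Omega> u x) \<bullet> grad \<Omega> v x = (grad \<Omega> u x v* A x) \<bullet> grad \<Omega> v x"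
      using elim vector_transpose_matrix[of "grad \<Omega> u x" "A x"] by simp
    also have "\<dots> = grad \<Omega> u x \<bullet> (A x *v grad \<Omega> v x)" by (rule dot_lmul_matrix)
    also have "\<dots> = (A x *v grad \<Omega> v x) \<bullet> grad \<Omega> u x" by (rule inner_commute)
    finally show ?case .
  qed
qed (rule borel_measurable_integrable[OF energy_integrable[OF assms[THEN H1_grad(2)]]]
    borel_measurable_integrable[OF energy_integrable[OF assms(2,1)[THEN H1_grad(2)]]])+

text \<open>
  As the gradient is linear only almost everywhere, the rules for the energy form are stated for
  any representative \<open>z\<close> of the linear combination.
\<close>

lemma energy_form_linear_right:
  assumes "u \<in> H1 \<Omega>" "v \<in> H1 \<Omega>" "w \<in> H1 \<Omega>" "eq_ae \<Omega> z (\<lambda>x. a * u x + b * v x)"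
  shows "energy_form \<Omega> A w z = a * energy_form \<Omega> A w u + b * energy_form \<Omega> A w v"
proof -
  note z = H1_linear_ae[OF assms(1,2,4)]
  note g = assms(1-3)[THEN H1_grad(2)] z(1)[THEN H1_grad(2)]
  have "energy_form \<Omega> A w z = (LINT x|lebesgue_on \<Omega>.
      a * ((A x *v grad \<Omega> w x) \<bullet> grad \<Omega> u x) + b * ((A x *v grad \<Omega> w x) \<bullet> grad \<Omega> v x))"
    unfolding energy_form_def
  proof (rule integral_cong_AE)
    show "AE x in lebesgue_on \<Omega>. (A x *v grad \<Omega> w x) \<bullet> grad \<Omega> z x =
        a * ((A x *v grad \<Omega> w x) \<bullet> grad \<Omega> u x) + b * ((A x *v grad \<Omega> w x) \<bullet> grad \<Omega> v x)"
      using z(2) unfolding eq_ae_def by eventually_elim (simp add: inner_add_right)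
  qed (use g in \<open>auto intro!: borel_measurable_integrable simp: energy_integrable\<close>)
  also have "\<dots> = a * energy_form \<Omega> A w u + b * energy_form \<Omega> A w v"
    using g by (simp add: energy_form_def energy_integrable)
  finally show ?thesis .
qed

lemma energy_form_linear_left:
  assumes "u \<in> H1 \<Omega>" "v \<in> H1 \<Omega>" "w \<in> H1 \<Omega>" "eq_ae \<Omega> z (\<lambda>x. a * u x + b * v x)"
  shows "energy_form \<Omega> A z w = a * energy_form \<Omega> A u w + b * energy_form \<Omega> A v w"
  using energy_form_linear_right[OF assms] assms H1_linear_ae(1)[OF assms(1,2,4)]
  by (simp add: energy_form_sym)

lemma energy_form_linear_square:
  assumes "u \<in> H1 \<Omega>" "v \<in> H1 \<Omega>" "eq_ae \<Omega> z (\<lambda>x. a * u x + b * v x)"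
  shows "energy_form \<Omega> A z z = a\<^sup>2 * energy_form \<Omega> A u u + 2 * a * b * energy_form \<Omega> A u v
    + b\<^sup>2 * energy_form \<Omega> A v v"
proof -
  have "z \<in> H1 \<Omega>" using assms by (rule H1_linear_ae(1))
  then show ?thesis
    using assms energy_form_linear_left[OF assms(1,2) _ assms(3), of z]
      energy_form_linear_right[OF assms(1,2) assms(1) assms(3)] energy_form_linear_right[OF assms(1,2) assms(2) assms(3)]
    by (simp add: energy_form_sym[of v u] power2_eq_square algebra_simps)
qed

lemma energy_form_coercive:
  assumes "u \<in> H1 \<Omega>"
  shows "\<alpha> * (L2_norm \<Omega> (grad \<Omega> u))\<^sup>2 \<le> energy_form \<Omega> A u u"
proof -
  note g = H1_grad(2)[OF assms]
  have "(LINT x|lebesgue_on \<Omega>. \<alpha> * (norm (grad \<Omega> u x))\<^sup>2) \<le> energy_form \<Omega> A u u"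
    unfolding energy_form_def
  proof (rule integral_mono_AE)
    have "AE x in lebesgue_on \<Omega>. \<forall>\<xi>. \<alpha> * (norm \<xi>)\<^sup>2 \<le> (A x *v \<xi>) \<bullet> \<xi>"
      using coefficient_A unfolding coefficient_def by auto
    then show "AE x in lebesgue_on \<Omega>. \<alpha> * (norm (grad \<Omega> u x))\<^sup>2 \<le> (A x *v grad \<Omega> u x) \<bullet> grad \<Omega> u x"
      by eventually_elim simp
  qed (use g energy_integrable[OF g g] in \<open>simp_all add: L2_def\<close>)
  then show ?thesis by (simp add: L2_norm_power2)
qed

lemma energy_form_le:
  assumes "0 \<le> \<beta>" "u \<in> H1 \<Omega>" "v \<in> H1 \<Omega>"
  shows "energy_form \<Omega> A u v \<le> \<beta> * (L2_norm \<Omega> (grad \<Omega> u) * L2_norm \<Omega> (grad \<Omega> v))"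
proof -
  note g = assms(2,3)[THEN H1_grad(2)]
  have "energy_form \<Omega> A u v \<le> (LINT x|lebesgue_on \<Omega>. \<beta> * (norm (grad \<Omega> u x) * norm (grad \<Omega> v x)))"
    unfolding energy_form_def
  proof (rule integral_mono_AE)
    have "AE x in lebesgue_on \<Omega>. \<forall>\<xi>. norm (A x *v \<xi>) \<le> \<beta> * norm \<xi>"
      using coefficient_A unfolding coefficient_def by auto
    then show "AE x in lebesgue_on \<Omega>. (A x *v grad \<Omega> u x) \<bullet> grad \<Omega> v x
        \<le> \<beta> * (norm (grad \<Omega> u x) * norm (grad \<Omega> v x))"
    proof eventually_elim
      case (elim x)
      have "(A x *v grad \<Omega> u x) \<bullet> grad \<Omega> v x \<le> norm (A x *v grad \<Omega> u x) * norm (grad \<Omega> v x)"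
        by (rule norm_cauchy_schwarz)
      also have "\<dots> \<le> (\<beta> * norm (grad \<Omega> u x)) * norm (grad \<Omega> v x)"
        using elim by (intro mult_right_mono) auto
      finally show ?case by (simp add: mult.assoc)
    qed
  qed (use energy_integrable[OF g] L2_integrable_inner(1)[OF g] in simp_all)
  also have "\<dots> \<le> \<beta> * (L2_norm \<Omega> (grad \<Omega> u) * L2_norm \<Omega> (grad \<Omega> v))"
    using L2_Cauchy_Schwarz_norm[OF g] assms(1) by (simp add: mult_left_mono)
  finally show ?thesis .
qed

end

section \<open>The multiscale space and its inverse inequality\<close>

text \<open>
  Of the trial spaces only linearity and the nesting inside \<open>H1\<close> matter for the stability argument,
  besides the two estimates for the interpolation operator and for discrete functions.
\<close>

locale multiscale_setting = elliptic_coefficient +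
  fixes V V\<^sub>H :: "(real^'n \<Rightarrow> real) set" and I\<^sub>H :: "(real^'n \<Rightarrow> real) \<Rightarrow> real^'n \<Rightarrow> real"
    and H C\<^sub>I C\<^sub>i\<^sub>n\<^sub>v :: real
  assumes V_subset_H1: "V \<subseteq> H1 \<Omega>"
    and V_linear: "\<And>u v a b. u \<in> V \<Longrightarrow> v \<in> V \<Longrightarrow> (\<lambda>x. a * u x + b * v x) \<in> V"
    and V\<^sub>H_subset_V: "V\<^sub>H \<subseteq> V"
    and V\<^sub>H_linear: "\<And>u v a b. u \<in> V\<^sub>H \<Longrightarrow> v \<in> V\<^sub>H \<Longrightarrow> (\<lambda>x. a * u x + b * v x) \<in> V\<^sub>H"
    and interpolation: "quasi_interpolation \<Omega> V V\<^sub>H H C\<^sub>I I\<^sub>H"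
    and inverse_ineq: "inverse_inequality \<Omega> V\<^sub>H H C\<^sub>i\<^sub>n\<^sub>v"
    and coercive: "0 < \<alpha>" and bounded_form: "0 < \<beta>"
    and constants: "0 < C\<^sub>i\<^sub>n\<^sub>v" "0 < H"
begin

abbreviation W :: "(real^'n \<Rightarrow> real) set" where
  "W \<equiv> interp_kernel \<Omega> V I\<^sub>H"

abbreviation VT :: "(real^'n \<Rightarrow> real) set" where
  "VT \<equiv> multiscale_space \<Omega> A W V\<^sub>H"

lemma in_H1: "v \<in> V \<Longrightarrow> v \<in> H1 \<Omega>" "v \<in> V\<^sub>H \<Longrightarrow> v \<in> H1 \<Omega>" "w \<in> W \<Longrightarrow> w \<in> H1 \<Omega>"
  using V_subset_H1 V\<^sub>H_subset_V by (auto simp: interp_kernel_def)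

lemma interpolation_linear:
  assumes "v \<in> V" "w \<in> V"
  shows "eq_ae \<Omega> (I\<^sub>H (\<lambda>x. a * v x + b * w x)) (\<lambda>x. a * I\<^sub>H v x + b * I\<^sub>H w x)"
  using interpolation assms unfolding quasi_interpolation_def by blast

lemma W_linear:
  assumes "v \<in> W" "w \<in> W"
  shows "(\<lambda>x. a * v x + b * w x) \<in> W"
proof -
  have vw: "v \<in> V" "w \<in> V" "eq_ae \<Omega> (I\<^sub>H v) (\<lambda>x. 0)" "eq_ae \<Omega> (I\<^sub>H w) (\<lambda>x. 0)"
    using assms by (auto simp: interp_kernel_def)
  have "eq_ae \<Omega> (I\<^sub>H (\<lambda>x. a * v x + b * w x)) (\<lambda>x. 0)"
    using eq_ae_trans[OF interpolation_linear[OF vw(1,2)] eq_ae_linear[OF vw(3,4)], of a b] by simp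
  with V_linear[OF vw(1,2)] show ?thesis by (simp add: interp_kernel_def)
qed

text \<open>
  The coefficients \<open>1\<close> and \<open>- 1\<close> bring the difference into the form of the linearity rules.
\<close>

lemma VT_cases:
  assumes "u \<in> VT"
  obtains v c where "v \<in> V\<^sub>H" "c \<in> W" "\<And>w. w \<in> W \<Longrightarrow> energy_form \<Omega> A c w = energy_form \<Omega> A v w"
    "eq_ae \<Omega> u (\<lambda>x. 1 * v x + (- 1) * c x)"
  using assms that by (auto simp: multiscale_space_def is_corrected_def is_corrector_def)

lemma VT_subset_H1: "u \<in> VT \<Longrightarrow> u \<in> H1 \<Omega>"
  by (erule VT_cases) (rule H1_linear_ae(1)[OF in_H1(2,3)])

lemma VT_linear:
  assumes "u \<in> VT" "u' \<in> VT"
  shows "(\<lambda>x. a * u x + b * u' x) \<in> VT"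
proof -
  obtain v c where v: "v \<in> V\<^sub>H" "c \<in> W" "\<And>w. w \<in> W \<Longrightarrow> energy_form \<Omega> A c w = energy_form \<Omega> A v w"
    "eq_ae \<Omega> u (\<lambda>x. 1 * v x + (- 1) * c x)" using assms(1) by (rule VT_cases) blast
  obtain v' c' where v': "v' \<in> V\<^sub>H" "c' \<in> W" "\<And>w. w \<in> W \<Longrightarrow> energy_form \<Omega> A c' w = energy_form \<Omega> A v' w"
    "eq_ae \<Omega> u' (\<lambda>x. 1 * v' x + (- 1) * c' x)" using assms(2) by (rule VT_cases) blast
  let ?v = "\<lambda>x. a * v x + b * v' x" and ?c = "\<lambda>x. a * c x + b * c' x"
  have "energy_form \<Omega> A ?c w = energy_form \<Omega> A ?v w" if w: "w \<in> W" for w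
    using energy_form_linear_left[OF in_H1(3)[OF v(2)] in_H1(3)[OF v'(2)] in_H1(3)[OF w] eq_ae_refl]
      energy_form_linear_left[OF in_H1(2)[OF v(1)] in_H1(2)[OF v'(1)] in_H1(3)[OF w] eq_ae_refl]
      v(3)[OF w] v'(3)[OF w] by simp
  then have "is_corrector \<Omega> A W ?v ?c"
    using W_linear[OF v(2) v'(2)] by (simp add: is_corrector_def)
  moreover have "eq_ae \<Omega> (\<lambda>x. a * u x + b * u' x) (\<lambda>x. ?v x - ?c x)"
    using eq_ae_linear[OF v(4) v'(4), of a b] by (simp add: algebra_simps)
  ultimately show ?thesis
    using V\<^sub>H_linear[OF v(1) v'(1)] unfolding multiscale_space_def is_corrected_def by blast
qed

text \<open>
  The rough functions \<open>u = v - c\<close> inherit an inverse inequality from the coarse mesh.  The corrector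
  \<open>c\<close> is the energy projection of \<open>v\<close> onto the kernel of the interpolation, so \<open>u\<close> has at most the
  energy of \<open>v\<close>.  On the other hand \<open>v\<close> is the interpolant of \<open>u\<close>, since interpolation fixes \<open>v\<close>
  and annihilates \<open>c\<close>.  Hence the inverse inequality for \<open>v\<close> followed by the \<open>L2\<close> stability of the
  interpolation bounds the energy of \<open>u\<close> by its own \<open>L2\<close> norm.
\<close>

lemma VT_inverse_inequality:
  assumes "u \<in> VT"
  shows "energy_form \<Omega> A u u \<le> \<beta> * C\<^sub>i\<^sub>n\<^sub>v\<^sup>2 * C\<^sub>I\<^sup>2 * inverse (H\<^sup>2) * (L2_norm \<Omega> u)\<^sup>2"
proof -
  obtain v c where v: "v \<in> V\<^sub>H" and c: "c \<in> W" "\<And>w. w \<in> W \<Longrightarrow> energy_form \<Omega> A c w = energy_form \<Omega> A v w"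
    and u: "eq_ae \<Omega> u (\<lambda>x. 1 * v x + (- 1) * c x)" using assms by (rule VT_cases) blast
  note H1 = in_H1(2)[OF v] in_H1(3)[OF c(1)]
  have vV: "v \<in> V" and cV: "c \<in> V" and Ic: "eq_ae \<Omega> (I\<^sub>H c) (\<lambda>x. 0)"
    using v c(1) V\<^sub>H_subset_V by (auto simp: interp_kernel_def)
  let ?u = "\<lambda>x. 1 * v x + (- 1) * c x"
  have "energy_form \<Omega> A u u = energy_form \<Omega> A v v - energy_form \<Omega> A c c"
    using energy_form_linear_square[OF H1 u] c(2)[OF c(1)] by simp
  also have "\<dots> \<le> energy_form \<Omega> A v v"
    using order_trans[OF _ energy_form_coercive[OF H1(2)], of 0] coercive by simp
  also have "\<dots> \<le> \<beta> * (L2_norm \<Omega> (grad \<Omega> v))\<^sup>2"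
    using energy_form_le[OF _ H1(1) H1(1)] bounded_form by (simp add: power2_eq_square)
  also have "\<dots> \<le> \<beta> * (C\<^sub>i\<^sub>n\<^sub>v * inverse H * (C\<^sub>I * L2_norm \<Omega> u))\<^sup>2"
  proof -
    have "eq_ae \<Omega> (I\<^sub>H ?u) (\<lambda>x. 1 * v x + (- 1) * 0)"
    proof (rule eq_ae_trans[OF interpolation_linear[OF vV cV] eq_ae_linear[OF _ Ic]])
      show "eq_ae \<Omega> (I\<^sub>H v) v"
        using interpolation v unfolding quasi_interpolation_def by blast
    qed
    then have Iu: "eq_ae \<Omega> v (I\<^sub>H ?u)" by (simp add: eq_ae_sym)
    have "L2_norm \<Omega> (grad \<Omega> v) \<le> C\<^sub>i\<^sub>n\<^sub>v * inverse H * L2_norm \<Omega> v"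
      using inverse_ineq v by (simp add: inverse_inequality_def)
    also have "L2_norm \<Omega> v = L2_norm \<Omega> (I\<^sub>H ?u)"
      using L2_cong_ae(2)[OF H1_grad(1)[OF H1(1)] Iu] by simp
    also have "\<dots> \<le> C\<^sub>I * L2_norm \<Omega> ?u"
      using interpolation V_linear[OF vV cV, of 1 "- 1"] unfolding quasi_interpolation_def by blast
    also have "L2_norm \<Omega> ?u = L2_norm \<Omega> u"
      using L2_cong_ae(2)[OF H1_grad(1)[OF VT_subset_H1[OF assms]] u] .
    finally have "L2_norm \<Omega> (grad \<Omega> v) \<le> C\<^sub>i\<^sub>n\<^sub>v * inverse H * (C\<^sub>I * L2_norm \<Omega> u)"
      using constants by (simp add: mult_left_mono)
    then show ?thesis
      using bounded_form by (intro mult_left_mono power_mono) (simp_all add: L2_norm_nonneg)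
  qed
  also have "\<dots> = \<beta> * C\<^sub>i\<^sub>n\<^sub>v\<^sup>2 * C\<^sub>I\<^sup>2 * inverse (H\<^sup>2) * (L2_norm \<Omega> u)\<^sup>2"
    by (simp add: power_mult_distrib power_inverse mult_ac)
  finally show ?thesis .
qed

section \<open>Conservation and coercivity of the leapfrog energy\<close>

definition discrete_energy :: "real \<Rightarrow> (nat \<Rightarrow> real^'n \<Rightarrow> real) \<Rightarrow> nat \<Rightarrow> real" where
  "discrete_energy \<tau> u n = (L2_norm \<Omega> (diff_quot \<tau> u n))\<^sup>2 + energy_form \<Omega> A (u n) (u (Suc n))"

lemma diff_quot_in_VT:
  assumes "u n \<in> VT" "u (Suc n) \<in> VT"
  shows "diff_quot \<tau> u n \<in> VT"
proof -
  have "diff_quot \<tau> u n = (\<lambda>x. (1 / \<tau>) * u (Suc n) x + (- 1 / \<tau>) * u n x)"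
    by (simp add: diff_quot_def diff_divide_distrib)
  then show ?thesis by (simp only: VT_linear[OF assms(2,1)])
qed

text \<open>
  The mixed term \<open>a (u n, u (n + 1))\<close> is the mean of the energies of both time levels minus
  \<open>\<tau>\<^sup>2 / 2\<close> times the energy of the difference quotient.  The latter is controlled by the inverse
  inequality, and the CFL condition says exactly that it uses up at most the fraction \<open>1 - \<delta>\<close> of the
  kinetic part.
\<close>

lemma discrete_energy_ge:
  assumes u: "u n \<in> VT" "u (Suc n) \<in> VT" and \<tau>: "0 < \<tau>"
    and CFL: "1 - 1/2 * \<beta> * C\<^sub>i\<^sub>n\<^sub>v\<^sup>2 * C\<^sub>I\<^sup>2 * inverse (H\<^sup>2) * \<tau>\<^sup>2 \<ge> \<delta>"
  shows "\<delta> * (L2_norm \<Omega> (diff_quot \<tau> u n))\<^sup>2 + \<alpha> / 2 * (L2_norm \<Omega> (grad \<Omega> (u (Suc n))))\<^sup>2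
    \<le> discrete_energy \<tau> u n"
proof -
  note H1 = u[THEN VT_subset_H1]
  define d where "d = (L2_norm \<Omega> (diff_quot \<tau> u n))\<^sup>2"
  define K where "K = \<beta> * C\<^sub>i\<^sub>n\<^sub>v\<^sup>2 * C\<^sub>I\<^sup>2 * inverse (H\<^sup>2)"
  let ?a = "energy_form \<Omega> A"
  have "eq_ae \<Omega> (diff_quot \<tau> u n) (\<lambda>x. (1 / \<tau>) * u (Suc n) x + (- 1 / \<tau>) * u n x)"
    by (simp add: diff_quot_def diff_divide_distrib eq_ae_refl)
  from energy_form_linear_square[OF H1(2,1) this]
  have "\<tau>\<^sup>2 * ?a (diff_quot \<tau> u n) (diff_quot \<tau> u n)
      = ?a (u (Suc n)) (u (Suc n)) - 2 * ?a (u n) (u (Suc n)) + ?a (u n) (u n)"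
    using \<tau> energy_form_sym[OF H1] by (simp add: field_simps power2_eq_square)
  moreover have "\<tau>\<^sup>2 * ?a (diff_quot \<tau> u n) (diff_quot \<tau> u n) \<le> \<tau>\<^sup>2 * (K * d)"
    using VT_inverse_inequality[OF diff_quot_in_VT[OF u]] unfolding K_def d_def
    by (intro mult_left_mono) simp_all
  moreover have "\<alpha> * (L2_norm \<Omega> (grad \<Omega> (u (Suc n))))\<^sup>2 \<le> ?a (u (Suc n)) (u (Suc n))"
    by (rule energy_form_coercive[OF H1(2)])
  moreover have "0 \<le> ?a (u n) (u n)"
    using order_trans[OF _ energy_form_coercive[OF H1(1)], of 0] coercive by simp
  moreover have "\<delta> * d \<le> (1 - 1/2 * K * \<tau>\<^sup>2) * d"
    using CFL unfolding K_def by (intro mult_right_mono) (simp_all add: d_def)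
  ultimately show ?thesis
    unfolding discrete_energy_def d_def[symmetric] by (simp add: algebra_simps)
qed

text \<open>
  Testing the scheme with \<open>u (n + 2) - u n\<close>, which is \<open>\<tau>\<close> times the sum of two consecutive
  difference quotients, makes the kinetic and the potential part telescope: without a source the
  energy is conserved exactly.
\<close>

lemma discrete_energy_step:
  assumes u: "u n \<in> VT" "u (Suc n) \<in> VT" "u (Suc (Suc n)) \<in> VT" and \<tau>: "0 < \<tau>" and f: "f \<in> L2 \<Omega>"
    and step: "\<And>v. v \<in> VT \<Longrightarrow>
      inverse (\<tau>\<^sup>2) * L2_inner \<Omega> (\<lambda>x. u (Suc (Suc n)) x - 2 * u (Suc n) x + u n x) v
        + energy_form \<Omega> A (u (Suc n)) v = L2_inner \<Omega> f v"
  shows "discrete_energy \<tau> u (Suc n) - discrete_energy \<tau> u n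
    \<le> \<tau> * L2_norm \<Omega> f * (L2_norm \<Omega> (diff_quot \<tau> u (Suc n)) + L2_norm \<Omega> (diff_quot \<tau> u n))"
proof -
  note H1 = u[THEN VT_subset_H1]
  let ?d = "diff_quot \<tau> u n" and ?e = "diff_quot \<tau> u (Suc n)"
  let ?v = "\<lambda>x. 1 * u (Suc (Suc n)) x + (- 1) * u n x"
  have d: "?d \<in> L2 \<Omega>" "?e \<in> L2 \<Omega>"
    using u by (auto intro!: H1_grad(1) VT_subset_H1 diff_quot_in_VT)
  have "inverse (\<tau>\<^sup>2) * L2_inner \<Omega> (\<lambda>x. u (Suc (Suc n)) x - 2 * u (Suc n) x + u n x) ?v
      = (LINT x|lebesgue_on \<Omega>. inverse (\<tau>\<^sup>2) * ((u (Suc (Suc n)) x - 2 * u (Suc n) x + u n x) * ?v x))"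
    by (simp add: L2_inner_def)
  also have "\<dots> = (LINT x|lebesgue_on \<Omega>. (norm (?e x))\<^sup>2 - (norm (?d x))\<^sup>2)"
    by (rule Bochner_Integration.integral_cong)
      (use \<tau> in \<open>simp_all add: diff_quot_def field_simps power2_eq_square\<close>)
  also have "\<dots> = (L2_norm \<Omega> ?e)\<^sup>2 - (L2_norm \<Omega> ?d)\<^sup>2"
    using d by (simp add: L2_norm_power2 L2_def)
  finally have kinetic: "inverse (\<tau>\<^sup>2) * L2_inner \<Omega> (\<lambda>x. u (Suc (Suc n)) x - 2 * u (Suc n) x + u n x) ?v
      = (L2_norm \<Omega> ?e)\<^sup>2 - (L2_norm \<Omega> ?d)\<^sup>2" .
  have potential: "energy_form \<Omega> A (u (Suc n)) ?v
      = energy_form \<Omega> A (u (Suc n)) (u (Suc (Suc n))) - energy_form \<Omega> A (u n) (u (Suc n))"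
    using energy_form_linear_right[OF H1(3,1,2) eq_ae_refl, of 1 "- 1"] energy_form_sym[OF H1(1,2)] by simp
  have "L2_inner \<Omega> f ?v = (LINT x|lebesgue_on \<Omega>. \<tau> * (f x * ?e x) + \<tau> * (f x * ?d x))"
    unfolding L2_inner_def
    by (rule Bochner_Integration.integral_cong) (use \<tau> in \<open>simp_all add: diff_quot_def field_simps\<close>)
  also have "\<dots> = \<tau> * L2_inner \<Omega> f ?e + \<tau> * L2_inner \<Omega> f ?d"
    using L2_integrable_inner(2)[OF f d(1)] L2_integrable_inner(2)[OF f d(2)] by (simp add: L2_inner_def)
  also have "\<dots> \<le> \<tau> * (L2_norm \<Omega> f * L2_norm \<Omega> ?e) + \<tau> * (L2_norm \<Omega> f * L2_norm \<Omega> ?d)"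
    using \<tau> L2_inner_le[OF f d(1)] L2_inner_le[OF f d(2)] by (intro add_mono mult_left_mono) simp_all
  finally have "L2_inner \<Omega> f ?v \<le> \<tau> * L2_norm \<Omega> f * (L2_norm \<Omega> ?e + L2_norm \<Omega> ?d)"
    by (simp add: algebra_simps)
  with step[OF VT_linear[OF u(3,1)], of 1 "- 1"] kinetic potential show ?thesis
    by (simp add: discrete_energy_def)
qed

end

text \<open>
  A discrete Gronwall argument without exponential growth: dividing the energy increment
  \<open>E (n + 1) - E n\<close> by \<open>sqrt (E (n + 1)) + sqrt (E n)\<close>, which dominates the factor \<open>d (n + 1) + d n\<close>
  on the right hand side up to \<open>sqrt \<delta>\<close>, leaves an increment of \<open>sqrt E\<close> by the size of the source
  only.
\<close>

lemma sqrt_energy_growth: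
  fixes E d F :: "nat \<Rightarrow> real"
  assumes \<delta>: "0 < \<delta>" and d: "\<And>n. n \<le> m \<Longrightarrow> 0 \<le> d n" and F: "\<And>n. 1 \<le> n \<Longrightarrow> n \<le> m \<Longrightarrow> 0 \<le> F n"
    and E: "\<And>n. n \<le> m \<Longrightarrow> \<delta> * (d n)\<^sup>2 \<le> E n"
    and step: "\<And>n. n < m \<Longrightarrow> E (Suc n) - E n \<le> F (Suc n) * (d (Suc n) + d n)"
  shows "sqrt (E m) \<le> sqrt (E 0) + (\<Sum>k=1..m. F k) / sqrt \<delta>"
  using assms(2-)
proof (induction m)
  case (Suc m)
  have d_le: "d n \<le> sqrt (E n) / sqrt \<delta>" if "n \<le> Suc m" for n
  proof -
    have "sqrt \<delta> * d n = sqrt (\<delta> * (d n)\<^sup>2)"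
      using Suc.prems(1)[OF that] by (simp add: real_sqrt_mult)
    also have "\<dots> \<le> sqrt (E n)" using Suc.prems(3)[OF that] by simp
    finally show ?thesis using \<delta> by (simp add: field_simps)
  qed
  have E0: "0 \<le> E n" if "n \<le> Suc m" for n
    using order_trans[OF _ Suc.prems(3)[OF that], of 0] \<delta> by simp
  have F0: "0 \<le> F (Suc m)" using Suc.prems(2) by simp
  have "sqrt (E (Suc m)) - sqrt (E m) \<le> F (Suc m) / sqrt \<delta>"
  proof (cases "sqrt (E (Suc m)) + sqrt (E m) = 0")
    case True
    moreover have "0 \<le> sqrt (E m)" using E0[of m] by simp
    ultimately have "sqrt (E (Suc m)) - sqrt (E m) \<le> 0" by linarith
    also have "0 \<le> F (Suc m) / sqrt \<delta>" using F0 \<delta> by simp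
    finally show ?thesis .
  next
    case False
    then have pos: "0 < sqrt (E (Suc m)) + sqrt (E m)" using E0[of m] E0[of "Suc m"] by (simp add: less_le)
    have "(sqrt (E (Suc m)) - sqrt (E m)) * (sqrt (E (Suc m)) + sqrt (E m)) = E (Suc m) - E m"
      using E0[of m] E0[of "Suc m"] by (simp add: algebra_simps)
    also have "\<dots> \<le> F (Suc m) * (d (Suc m) + d m)" using Suc.prems(4) by simp
    also have "\<dots> \<le> F (Suc m) * (sqrt (E (Suc m)) / sqrt \<delta> + sqrt (E m) / sqrt \<delta>)"
      using d_le F0 by (intro mult_left_mono add_mono) simp_all
    also have "\<dots> = F (Suc m) / sqrt \<delta> * (sqrt (E (Suc m)) + sqrt (E m))"
      by (simp add: distrib_left add_divide_distrib)
    finally show ?thesis using pos by (rule mult_right_le_imp_le)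
  qed
  moreover have "sqrt (E m) \<le> sqrt (E 0) + (\<Sum>k=1..m. F k) / sqrt \<delta>"
    using Suc.prems by (intro Suc.IH) auto
  ultimately show ?case by (simp add: add_divide_distrib)
qed simp

section \<open>Stability of the idealized method\<close>

context multiscale_setting
begin

text \<open>
  The square root of the energy dominates both the difference quotient and the gradient at the new
  time level, grows at most by the accumulated source, and is initially bounded by the data.
\<close>

lemma idealized_method_stable:
  assumes \<delta>: "0 < \<delta>" and \<tau>: "0 < \<tau>"
    and CFL: "1 - 1/2 * \<beta> * C\<^sub>i\<^sub>n\<^sub>v\<^sup>2 * C\<^sub>I\<^sup>2 * inverse (H\<^sup>2) * \<tau>\<^sup>2 \<ge> \<delta>"
    and f: "\<And>t. 0 < t \<Longrightarrow> t < T \<Longrightarrow> f t \<in> L2 \<Omega>"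
    and sol: "idealized_solution \<Omega> A V V\<^sub>H I\<^sub>H T \<tau> f u\<^sub>0 u"
    and n: "n < num_steps T \<tau>"
  shows "L2_norm \<Omega> (diff_quot \<tau> u n) + L2_norm \<Omega> (grad \<Omega> (u (n + 1)))
      \<le> (1 / sqrt \<delta> + sqrt (2 / \<alpha>)) * (1 + sqrt \<beta> + 1 / sqrt \<delta>) *
        (\<tau> * (\<Sum>k=1..n. L2_norm \<Omega> (f (real k * \<tau>))) + L2_norm \<Omega> (diff_quot \<tau> u 0)
               + L2_norm \<Omega> (grad \<Omega> (u 0)) + L2_norm \<Omega> (grad \<Omega> (u 1)))"
proof -
  let ?N = "num_steps T \<tau>"
  have u: "u j \<in> VT" if "j \<le> ?N" for j
    using sol that by (simp add: idealized_solution_def Let_def)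
  have scheme: "inverse (\<tau>\<^sup>2) * L2_inner \<Omega> (\<lambda>x. u (j + 1) x - 2 * u j x + u (j - 1) x) v
            + energy_form \<Omega> A (u j) v = L2_inner \<Omega> (f (real j * \<tau>)) v"
    if "1 \<le> j" "j < ?N" "v \<in> VT" for j v
    using sol that by (simp add: idealized_solution_def Let_def)
  \<comment> \<open>the number of steps is rounded up, so \<open>j < N\<close> gives \<open>j * \<tau> < T\<close>\<close>
  have fj: "f (real j * \<tau>) \<in> L2 \<Omega>" if "1 \<le> j" "j < ?N" for j
  proof (rule f)
    show "0 < real j * \<tau>" using that \<tau> by simp
    have "real j < T / \<tau>" using that unfolding num_steps_def by linarith
    then show "real j * \<tau> < T" using \<tau> by (simp add: field_simps)
  qed
  define d where "d j = L2_norm \<Omega> (diff_quot \<tau> u j)" for j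
  define g where "g j = L2_norm \<Omega> (grad \<Omega> (u j))" for j
  define S where "S = \<tau> * (\<Sum>k=1..n. L2_norm \<Omega> (f (real k * \<tau>)))"
  let ?E = "discrete_energy \<tau> u"
  have nonneg: "0 \<le> d j" "0 \<le> g j" "0 \<le> S" for j
    using \<tau> by (simp_all add: d_def g_def S_def L2_norm_nonneg sum_nonneg)
  have lower: "\<delta> * (d j)\<^sup>2 + \<alpha> / 2 * (g (Suc j))\<^sup>2 \<le> ?E j" if "j \<le> n" for j
    unfolding d_def g_def using that n by (intro discrete_energy_ge[OF _ _ \<tau> CFL] u) auto
  have "sqrt (?E n) \<le> sqrt (?E 0) + (\<Sum>k=1..n. \<tau> * L2_norm \<Omega> (f (real k * \<tau>))) / sqrt \<delta>"
  proof (rule sqrt_energy_growth[where d = d])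
    show "\<delta> * (d j)\<^sup>2 \<le> ?E j" if "j \<le> n" for j
    proof -
      have "0 \<le> \<alpha> / 2 * (g (Suc j))\<^sup>2" using coercive by simp
      with lower[OF that] show ?thesis by linarith
    qed
    show "?E (Suc j) - ?E j \<le> \<tau> * L2_norm \<Omega> (f (real (Suc j) * \<tau>)) * (d (Suc j) + d j)"
      if "j < n" for j
      unfolding d_def
    proof (rule discrete_energy_step[OF _ _ _ \<tau>])
      show "inverse (\<tau>\<^sup>2) * L2_inner \<Omega> (\<lambda>x. u (Suc (Suc j)) x - 2 * u (Suc j) x + u j x) v
        + energy_form \<Omega> A (u (Suc j)) v = L2_inner \<Omega> (f (real (Suc j) * \<tau>)) v" if "v \<in> VT" for v
        using scheme[of "Suc j" v] that \<open>j < n\<close> n by simp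
      show "f (real (Suc j) * \<tau>) \<in> L2 \<Omega>"
        using fj[of "Suc j"] that n by simp
    qed (use that n u in auto)
  qed (use \<delta> \<tau> nonneg in \<open>simp_all add: L2_norm_nonneg\<close>)
  then have growth: "sqrt (?E n) \<le> sqrt (?E 0) + S / sqrt \<delta>"
    by (simp add: S_def sum_distrib_left)
  have "?E 0 \<le> (d 0)\<^sup>2 + \<beta> * (g 0 * g 1)"
    using energy_form_le[of "u 0" "u 1"] u[of 0] u[of 1] n bounded_form
    by (simp add: discrete_energy_def d_def g_def VT_subset_H1)
  also have "\<dots> \<le> (d 0 + sqrt \<beta> * (g 0 + g 1))\<^sup>2"
  proof -
    define G where "G = g 0 + g 1"
    have G: "0 \<le> G" "g 0 * g 1 \<le> G\<^sup>2"
      using nonneg(2)[of 0] nonneg(2)[of 1] by (simp_all add: G_def power2_sum)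
    have "\<beta> * (g 0 * g 1) \<le> \<beta> * G\<^sup>2"
      using G(2) bounded_form by (simp add: mult_left_mono)
    moreover have "0 \<le> 2 * d 0 * (sqrt \<beta> * G)"
      using nonneg(1)[of 0] G(1) bounded_form by simp
    moreover have "(d 0 + sqrt \<beta> * G)\<^sup>2 = (d 0)\<^sup>2 + \<beta> * G\<^sup>2 + 2 * d 0 * (sqrt \<beta> * G)"
      using bounded_form by (simp add: power2_sum power_mult_distrib)
    ultimately show ?thesis unfolding G_def[symmetric] by linarith
  qed
  finally have initial: "sqrt (?E 0) \<le> d 0 + sqrt \<beta> * (g 0 + g 1)"
    using nonneg(1)[of 0] nonneg(2)[of 0] nonneg(2)[of 1] nonneg(3) bounded_form by (intro real_le_lsqrt) simp_all
  define R where "R = S + d 0 + g 0 + g 1"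
  have bound: "sqrt (?E n) \<le> (1 + sqrt \<beta> + 1 / sqrt \<delta>) * R"
  proof -
    have "0 \<le> sqrt \<beta> * (S + d 0)" "0 \<le> 1 / sqrt \<delta> * (d 0 + g 0 + g 1)" "0 \<le> S + g 0 + g 1"
      using nonneg(1)[of 0] nonneg(2)[of 0] nonneg(2)[of 1] nonneg(3) bounded_form \<delta> by simp_all
    with growth initial show ?thesis by (simp add: R_def algebra_simps)
  qed
  have "d n \<le> 1 / sqrt \<delta> * sqrt (?E n)"
  proof -
    have "0 \<le> \<alpha> / 2 * (g (Suc n))\<^sup>2" using coercive by simp
    then have "\<delta> * (d n)\<^sup>2 \<le> ?E n" using lower[of n] by simp
    then have "sqrt (\<delta> * (d n)\<^sup>2) \<le> sqrt (?E n)" by simp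
    then show ?thesis using nonneg(1)[of n] \<delta> by (simp add: real_sqrt_mult field_simps)
  qed
  moreover have "g (Suc n) \<le> sqrt (2 / \<alpha>) * sqrt (?E n)"
  proof -
    have "0 \<le> \<delta> * (d n)\<^sup>2" using \<delta> by simp
    then have "\<alpha> / 2 * (g (Suc n))\<^sup>2 \<le> ?E n" using lower[of n] by simp
    then have "(g (Suc n))\<^sup>2 \<le> 2 / \<alpha> * ?E n" using coercive by (simp add: field_simps)
    then have "g (Suc n) \<le> sqrt (2 / \<alpha> * ?E n)" by (rule real_le_rsqrt)
    then show ?thesis by (simp only: real_sqrt_mult)
  qed
  ultimately have "d n + g (Suc n) \<le> (1 / sqrt \<delta> + sqrt (2 / \<alpha>)) * sqrt (?E n)"
    by (simp add: distrib_right)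
  also have "\<dots> \<le> (1 / sqrt \<delta> + sqrt (2 / \<alpha>)) * ((1 + sqrt \<beta> + 1 / sqrt \<delta>) * R)"
    using bound coercive \<delta> by (intro mult_left_mono) simp_all
  finally show ?thesis by (simp add: d_def g_def R_def S_def mult.assoc)
qed

end

theorem lemma2p3:
  fixes \<Omega> \<Gamma> :: "(real^'n) set" and \<alpha> \<beta> \<gamma> \<kappa> C\<^sub>i\<^sub>n\<^sub>v C\<^sub>I \<delta> :: real
  assumes "CARD('n) \<in> {2, 3}"
    and "polygonal_convex_domain \<Omega>"
    and "\<Gamma> \<subseteq> frontier \<Omega>" and "hausdorff_outer (CARD('n) - 1) \<Gamma> \<noteq> 0"
    and "0 < \<alpha>" and "\<alpha> \<le> \<beta>"
    and "0 < C\<^sub>i\<^sub>n\<^sub>v" and "0 < C\<^sub>I" and "0 < \<delta>"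
  shows "\<exists>C\<^sub>s>0. \<forall>(A :: real^'n \<Rightarrow> real^'n^'n) (\<epsilon> :: real) (k :: fe_kind)
      (\<T> :: (real^'n \<Rightarrow> real^'n) set) (H :: real) (I\<^sub>H :: (real^'n \<Rightarrow> real) \<Rightarrow> real^'n \<Rightarrow> real)
      (T :: real) (\<Delta>t :: real) (f :: real \<Rightarrow> real^'n \<Rightarrow> real) (u\<^sub>0 :: real^'n \<Rightarrow> real)
      (u :: nat \<Rightarrow> real^'n \<Rightarrow> real).
    coefficient \<Omega> \<alpha> \<beta> A \<longrightarrow>
    is_mesh \<Omega> k \<T> \<longrightarrow> shape_regular k \<gamma> \<T> \<longrightarrow> quasi_uniform k \<kappa> \<T> \<longrightarrow>
    H = mesh_size k \<T> \<longrightarrow> 0 < \<epsilon> \<longrightarrow> \<epsilon> < H \<longrightarrow>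
    inverse_inequality \<Omega> (fe_space \<Omega> \<Gamma> k \<T>) H C\<^sub>i\<^sub>n\<^sub>v \<longrightarrow>
    quasi_interpolation \<Omega> (H1_zero_on \<Omega> \<Gamma>) (fe_space \<Omega> \<Gamma> k \<T>) H C\<^sub>I I\<^sub>H \<longrightarrow>
    0 < T \<longrightarrow> 0 < \<Delta>t \<longrightarrow>
    (\<forall>t\<in>{0<..<T}. f t \<in> L2 \<Omega>) \<longrightarrow> u\<^sub>0 \<in> H1_zero_on \<Omega> \<Gamma> \<longrightarrow>
    idealized_solution \<Omega> A (H1_zero_on \<Omega> \<Gamma>) (fe_space \<Omega> \<Gamma> k \<T>) I\<^sub>H T \<Delta>t f u\<^sub>0 u \<longrightarrow>
    1 - 1/2 * \<beta> * C\<^sub>i\<^sub>n\<^sub>v\<^sup>2 * C\<^sub>I\<^sup>2 * inverse (H\<^sup>2) * \<Delta>t\<^sup>2 \<ge> \<delta> \<longrightarrow>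
    (\<forall>n<num_steps T \<Delta>t.
      L2_norm \<Omega> (diff_quot \<Delta>t u n) + L2_norm \<Omega> (grad \<Omega> (u (n + 1)))
      \<le> C\<^sub>s * (\<Delta>t * (\<Sum>k=1..n. L2_norm \<Omega> (f (real k * \<Delta>t))) + L2_norm \<Omega> (diff_quot \<Delta>t u 0)
               + L2_norm \<Omega> (grad \<Omega> (u 0)) + L2_norm \<Omega> (grad \<Omega> (u 1))))"
proof (intro exI[of _ "(1 / sqrt \<delta> + sqrt (2 / \<alpha>)) * (1 + sqrt \<beta> + 1 / sqrt \<delta>)"] conjI allI impI)
  show "0 < (1 / sqrt \<delta> + sqrt (2 / \<alpha>)) * (1 + sqrt \<beta> + 1 / sqrt \<delta>)"
    using assms by (intro mult_pos_pos add_pos_pos) simp_all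
next
  fix A :: "real^'n \<Rightarrow> real^'n^'n" and \<epsilon> :: real and k :: fe_kind
    and \<T> :: "(real^'n \<Rightarrow> real^'n) set" and H :: real and I\<^sub>H :: "(real^'n \<Rightarrow> real) \<Rightarrow> real^'n \<Rightarrow> real"
    and T \<Delta>t :: real and f :: "real \<Rightarrow> real^'n \<Rightarrow> real" and u\<^sub>0 :: "real^'n \<Rightarrow> real"
    and u :: "nat \<Rightarrow> real^'n \<Rightarrow> real" and n :: nat
  assume A: "coefficient \<Omega> \<alpha> \<beta> A" and H: "0 < \<epsilon>" "\<epsilon> < H"
    and inv: "inverse_inequality \<Omega> (fe_space \<Omega> \<Gamma> k \<T>) H C\<^sub>i\<^sub>n\<^sub>v"
    and I: "quasi_interpolation \<Omega> (H1_zero_on \<Omega> \<Gamma>) (fe_space \<Omega> \<Gamma> k \<T>) H C\<^sub>I I\<^sub>H"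
    and \<Delta>t: "0 < \<Delta>t" and f: "\<forall>t\<in>{0<..<T}. f t \<in> L2 \<Omega>"
    and sol: "idealized_solution \<Omega> A (H1_zero_on \<Omega> \<Gamma>) (fe_space \<Omega> \<Gamma> k \<T>) I\<^sub>H T \<Delta>t f u\<^sub>0 u"
    and CFL: "1 - 1/2 * \<beta> * C\<^sub>i\<^sub>n\<^sub>v\<^sup>2 * C\<^sub>I\<^sup>2 * inverse (H\<^sup>2) * \<Delta>t\<^sup>2 \<ge> \<delta>"
    and n: "n < num_steps T \<Delta>t"
  interpret bounded_open_set \<Omega>
    using assms(2) by unfold_locales (auto simp: polygonal_convex_domain_def)
  interpret multiscale_setting \<Omega> A \<alpha> \<beta> "H1_zero_on \<Omega> \<Gamma>" "fe_space \<Omega> \<Gamma> k \<T>" I\<^sub>H H C\<^sub>I C\<^sub>i\<^sub>n\<^sub>v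
    by unfold_locales
      (use A inv I H assms in \<open>auto intro: H1_zero_on_linear fe_space_linear
        subsetD[OF H1_zero_on_subset_H1] subsetD[OF fe_space_subset]\<close>)
  show "L2_norm \<Omega> (diff_quot \<Delta>t u n) + L2_norm \<Omega> (grad \<Omega> (u (n + 1)))
      \<le> (1 / sqrt \<delta> + sqrt (2 / \<alpha>)) * (1 + sqrt \<beta> + 1 / sqrt \<delta>) *
        (\<Delta>t * (\<Sum>k=1..n. L2_norm \<Omega> (f (real k * \<Delta>t))) + L2_norm \<Omega> (diff_quot \<Delta>t u 0)
               + L2_norm \<Omega> (grad \<Omega> (u 0)) + L2_norm \<Omega> (grad \<Omega> (u 1)))"
    by (rule idealized_method_stable[OF assms(9) \<Delta>t CFL _ sol n]) (use f in simp)
qed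

end
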